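(* Let $d\geq 2$ and $q\geq 2$ be integers, and let $H^<$ be an ordered $d$-degenerate graph on $n\geq 3$ vertices, with at least one edge, with interval chromatic number $\chi$, and with a degeneracy ordering $v_1,\dots,v_n$ of its vertices (each $v_i$ has at most $d$ neighbors among $v_1,\dots,v_{i-1}$). Let $p\geq 2$ be an integer such that for every edge $v_iv_j$ of $H^<$ with $i<j$, the vertices $v_i$ and $v_j$ have at most $p-1$ common neighbors among $v_1,\dots,v_{i-1}$. Then \[ r_<(H^<;q)\leq n^{60dp^{q-2}\lceil\log\chi\rceil^{q-1}}. \]
   Context: Logarithms are to base two. An ordered graph $G^<$ is a finite graph together with a linear order on its vertex set. The degeneracy ordering $v_1,\dots,v_n$ need not agree with this given vertex order. An ordered copy of $H^<$ in $G^<$ is given by an increasing injection $f\colon V(H)\to V(G)$ with $f(u)f(v)\in E(G)$ whenever $uv\in E(H)$. The interval chromatic number of $G^<$ is the minimum number of intervals (of the vertex order) into which $V(G)$ can be partitioned so that no two vertices in the same interval are adjacent. A graph is $d$-degenerate if each of its nonempty subgraphs has a vertex of degree at most $d$. $K_N^<$ is the ordered complete graph on $N$ vertices. The ordered Ramsey number $r_<(H^<;q)$ is the smallest $N$ such that every coloring of the edges of $K_N^<$ with $q$ colors contains a monochromatic ordered copy of $H^<$. *)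

theory Defs
  imports Complex_Main "HOL-Library.Ramsey" "HOL-Library.Disjoint_Sets"
begin

text \<open>
  An ordered graph is a pair of a finite vertex set and a set of two-element subsets of it; the
  vertex order is the one inherited from the linearly ordered vertex type.
\<close>

definition ordered_graph :: "'a::linorder set \<Rightarrow> 'a set set \<Rightarrow> bool" where
  "ordered_graph V E \<longleftrightarrow> finite V \<and> E \<subseteq> [V]\<^bsup>2\<^esup>"

definition nbrs :: "'a set set \<Rightarrow> 'a \<Rightarrow> 'a set" where
  "nbrs E v = {u. {u, v} \<in> E}"

definition subgraph_of :: "'a set \<Rightarrow> 'a set set \<Rightarrow> 'a set \<Rightarrow> 'a set set \<Rightarrow> bool" where
  "subgraph_of W F V E \<longleftrightarrow> W \<subseteq> V \<and> F \<subseteq> E \<and> F \<subseteq> [W]\<^bsup>2\<^esup>"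

definition degenerate :: "nat \<Rightarrow> 'a set \<Rightarrow> 'a set set \<Rightarrow> bool" where
  "degenerate d V E \<longleftrightarrow>
     (\<forall>W F. subgraph_of W F V E \<and> W \<noteq> {} \<longrightarrow> (\<exists>v\<in>W. card (nbrs F v) \<le> d))"

text \<open>The enumeration \<open>v 1, \<dots>, v n\<close> is unrelated to the order on the vertex type.\<close>

definition degeneracy_ordering :: "nat \<Rightarrow> 'a set \<Rightarrow> 'a set set \<Rightarrow> (nat \<Rightarrow> 'a) \<Rightarrow> bool" where
  "degeneracy_ordering d V E v \<longleftrightarrow>
     bij_betw v {1..card V} V \<and>
     (\<forall>i\<in>{1..card V}. card (nbrs E (v i) \<inter> v ` {1..<i}) \<le> d)"

definition interval_in :: "'a::linorder set \<Rightarrow> 'a set \<Rightarrow> bool" where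
  "interval_in V I \<longleftrightarrow> I \<subseteq> V \<and> (\<forall>x\<in>I. \<forall>z\<in>I. \<forall>y\<in>V. x \<le> y \<and> y \<le> z \<longrightarrow> y \<in> I)"

definition interval_colouring :: "'a::linorder set \<Rightarrow> 'a set set \<Rightarrow> 'a set set \<Rightarrow> bool" where
  "interval_colouring V E P \<longleftrightarrow>
     partition_on V P \<and> (\<forall>I\<in>P. interval_in V I \<and> (\<forall>u\<in>I. \<forall>w\<in>I. {u, w} \<notin> E))"

definition interval_chromatic_number :: "'a::linorder set \<Rightarrow> 'a set set \<Rightarrow> nat" where
  "interval_chromatic_number V E = (LEAST k. \<exists>P. interval_colouring V E P \<and> card P = k)"

definition ordered_copy ::
  "'a::linorder set \<Rightarrow> 'a set set \<Rightarrow> 'b::linorder set \<Rightarrow> 'b set set \<Rightarrow> bool" where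
  "ordered_copy V E W F \<longleftrightarrow>
     (\<exists>f. strict_mono_on V f \<and> f ` V \<subseteq> W \<and> (\<forall>u w. {u, w} \<in> E \<longrightarrow> {f u, f w} \<in> F))"

text \<open>
  The ordered complete graph on \<open>N\<close> vertices has vertex set \<open>{..<N}\<close> and edge set
  \<open>[{..<N}]\<^bsup>2\<^esup>\<close>. A monochromatic ordered copy is an ordered copy in one of the colour classes.
\<close>

definition ordered_arrows :: "nat \<Rightarrow> 'a::linorder set \<Rightarrow> 'a set set \<Rightarrow> nat \<Rightarrow> bool" where
  "ordered_arrows N V E q \<longleftrightarrow>
     (\<forall>c \<in> [{..<N}]\<^bsup>2\<^esup> \<rightarrow> {..<q}.
        \<exists>i<q. ordered_copy V E {..<N} {e \<in> [{..<N}]\<^bsup>2\<^esup>. c e = i})"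

definition ordered_ramsey_number :: "'a::linorder set \<Rightarrow> 'a set set \<Rightarrow> nat \<Rightarrow> nat" where
  "ordered_ramsey_number V E q = (LEAST N. ordered_arrows N V E q)"

text \<open>For every ordered graph, the two minima above range over nonempty sets.\<close>

lemma interval_colouring_exists:
  assumes "ordered_graph V E"
  shows "\<exists>P. interval_colouring V E P"
proof
  have "{u} \<notin> E" for u
    using assms by (auto simp: ordered_graph_def nsets_def)
  then show "interval_colouring V E ((\<lambda>u. {u}) ` V)"
    by (auto simp: interval_colouring_def interval_in_def partition_on_def disjoint_def)
qed

lemma strict_mono_on_into_exists:
  fixes V :: "'a::linorder set" and H :: "'b::linorder set"
  assumes "finite V" "finite H" "card H = card V"
  shows "\<exists>f. strict_mono_on V f \<and> f ` V \<subseteq> H"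
proof -
  define r where "r x = card {y \<in> V. y < x}" for x
  have r: "r x < card V" if "x \<in> V" for x
    unfolding r_def using that assms(1) by (intro psubset_card_mono) auto
  have r_mono: "r x < r y" if "x \<in> V" "x < y" for x y
    unfolding r_def using that assms(1) by (intro psubset_card_mono) auto
  let ?f = "\<lambda>x. sorted_list_of_set H ! r x"
  have "strict_mono_on V ?f"
    using r r_mono assms sorted_wrt_nth_less[OF strict_sorted_list_of_set[of H]]
    by (auto simp: strict_mono_on_def)
  moreover have "?f x \<in> H" if "x \<in> V" for x
    using r[OF that] assms nth_mem[of "r x" "sorted_list_of_set H"] by simp
  ultimately show ?thesis
    by blast
qed

lemma ordered_arrows_exists:
  assumes "ordered_graph V E"
  shows "\<exists>N. ordered_arrows N V E q"
proof -
  obtain N :: nat where N: "partn_lst {..<N} (replicate q (card V)) 2"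
    using ramsey_full by blast
  have "ordered_arrows N V E q"
    unfolding ordered_arrows_def
  proof
    fix c assume c: "c \<in> [{..<N}]\<^bsup>2\<^esup> \<rightarrow> {..<q}"
    then obtain i H where i: "i < q" and H: "H \<in> [{..<N}]\<^bsup>card V\<^esup>" "c ` [H]\<^bsup>2\<^esup> \<subseteq> {i}"
      using N by (fastforce simp: partn_lst_def monochromatic_def)
    then obtain f where f: "strict_mono_on V f" "f ` V \<subseteq> H"
      using strict_mono_on_into_exists[of V H] assms by (auto simp: nsets_def ordered_graph_def)
    have edge: "{f u, f w} \<in> [H]\<^bsup>2\<^esup>" if "{u, w} \<in> E" for u w
    proof -
      have uw: "u \<in> V" "w \<in> V" "u \<noteq> w"
        using that assms by (auto simp: ordered_graph_def nsets_2_eq doubleton_eq_iff)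
      then have "f u \<noteq> f w"
        using f(1) by (metis strict_mono_on_imp_inj_on inj_onD)
      then show ?thesis
        using uw f(2) by (auto simp: nsets_2_eq)
    qed
    have "H \<subseteq> {..<N}"
      using H(1) by (simp add: nsets_def)
    then have "{f u, f w} \<in> {e \<in> [{..<N}]\<^bsup>2\<^esup>. c e = i}" if "{u, w} \<in> E" for u w
      using edge[OF that] H(2) nsets_mono[of H "{..<N}" 2] by blast
    with f \<open>H \<subseteq> {..<N}\<close> have "ordered_copy V E {..<N} {e \<in> [{..<N}]\<^bsup>2\<^esup>. c e = i}"
      unfolding ordered_copy_def by blast
    with i show "\<exists>i<q. ordered_copy V E {..<N} {e \<in> [{..<N}]\<^bsup>2\<^esup>. c e = i}"
      by blast
  qed
  then show ?thesis ..
qed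

end

theory Submission
  imports Defs
begin

text \<open>
  Suppose that there is no monochromatic copy, and treat the colours one after the other. After \<open>s\<close>
  colours, every large vertex set contains sets \<open>Y u\<close>, one for each vertex \<open>u\<close> of the pattern and ordered
  like these, between which (along edges of the pattern) the first \<open>s\<close> colours have tiny density.

  To pass to the next colour, embed the pattern greedily in that colour, in the degeneracy order, each
  choice restricting the candidate sets of the later neighbours by a factor \<open>\<eta> = \<epsilon> / n\<close>. The density of the
  old colours between two candidate sets is under control if the heaviest vertices are pruned before each
  restriction: only restricting both sets at once may increase it, by \<open>1 / \<eta>\<close>, which happens at most
  \<open>p - 1\<close> times per edge. The embedding fails, so at some point many candidates have few neighbours of
  the new colour in one candidate set; as the old colours are still sparse there, this is a pair of large
  sets between which all colours up to the new one are sparse. Iterating inside both sets of the pair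
  \<open>\<lceil>log \<chi>\<rceil>\<close> times gives \<open>\<chi>\<close> consecutive sets with sparse pairs, and cutting each of them into \<open>n\<close>
  pieces gives the sets \<open>Y u\<close> for the next round.

  When all colours but the last are sparse, the densities sum to less than \<open>1\<close>, and averaging gives a
  choice of one vertex per set with all pattern edges in the last colour.
\<close>

section \<open>Average degrees and densities\<close>

text \<open>The weight \<beta> will measure the colours already treated. Over an empty set both
  quantities are 0 by the convention for division, which is why \<open>dens_le\<close> asks for a
  nonnegative bound.\<close>

definition avdeg :: "('b \<Rightarrow> 'b \<Rightarrow> real) \<Rightarrow> 'b \<Rightarrow> 'b set \<Rightarrow> real" where
  "avdeg \<beta> x C = (\<Sum>y\<in>C. \<beta> x y) / card C"

definition dens :: "('b \<Rightarrow> 'b \<Rightarrow> real) \<Rightarrow> 'b set \<Rightarrow> 'b set \<Rightarrow> real" where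
  "dens \<beta> A C = (\<Sum>x\<in>A. avdeg \<beta> x C) / card A"

lemma avdeg_nonneg: "(\<And>x y. 0 \<le> \<beta> x y) \<Longrightarrow> 0 \<le> avdeg \<beta> x C"
  by (simp add: avdeg_def sum_nonneg)

lemma dens_nonneg: "(\<And>x y. 0 \<le> \<beta> x y) \<Longrightarrow> 0 \<le> dens \<beta> A C"
  by (simp add: dens_def sum_nonneg avdeg_nonneg)

lemma dens_commute:
  assumes "\<And>x y. \<beta> x y = \<beta> y x"
  shows "dens \<beta> A C = dens \<beta> C A"
proof -
  have "dens \<beta> A C = (\<Sum>x\<in>A. \<Sum>y\<in>C. \<beta> x y) / (card A * card C)"
    by (simp add: dens_def avdeg_def mult.commute flip: sum_divide_distrib)
  also have "\<dots> = (\<Sum>y\<in>C. \<Sum>x\<in>A. \<beta> y x) / (card A * card C)"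
    by (subst sum.swap) (simp add: assms)
  also have "\<dots> = dens \<beta> C A"
    by (simp add: dens_def avdeg_def mult.commute flip: sum_divide_distrib)
  finally show ?thesis .
qed

lemma dens_le:
  assumes "\<And>x. x \<in> A \<Longrightarrow> avdeg \<beta> x C \<le> r" "0 \<le> r"
  shows "dens \<beta> A C \<le> r"
proof -
  have "(\<Sum>x\<in>A. avdeg \<beta> x C) \<le> card A * r"
    using sum_bounded_above[of A "\<lambda>x. avdeg \<beta> x C" r] assms(1) by simp
  then show ?thesis
    using assms(2) by (cases "card A = 0") (auto simp: dens_def field_simps)
qed

lemma avdeg_subset:
  fixes \<eta> :: real
  assumes "\<And>x y. 0 \<le> \<beta> x y" "finite C" "D \<subseteq> C" "0 < \<eta>" "\<eta> * card C \<le> card D"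
  shows "\<eta> * avdeg \<beta> x D \<le> avdeg \<beta> x C"
proof (cases "card C = 0")
  case True
  then have "D = {}" using assms by auto
  then show ?thesis using True by (simp add: avdeg_def)
next
  case False
  then have pos: "0 < \<eta> * card C" using assms(4) by simp
  have "\<eta> * avdeg \<beta> x D = \<eta> * (\<Sum>y\<in>D. \<beta> x y) / card D"
    by (simp add: avdeg_def)
  also have "\<dots> \<le> \<eta> * (\<Sum>y\<in>D. \<beta> x y) / (\<eta> * card C)"
    using assms pos by (intro divide_left_mono mult_nonneg_nonneg sum_nonneg) auto
  also have "\<dots> = (\<Sum>y\<in>D. \<beta> x y) / card C"
    using assms(4) by simp
  also have "\<dots> \<le> avdeg \<beta> x C"
    unfolding avdeg_def using assms by (intro divide_right_mono sum_mono2) auto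
  finally show ?thesis .
qed

lemma markov_card:
  fixes w :: "'b \<Rightarrow> real" and r s :: real
  assumes "finite C" "\<And>y. y \<in> C \<Longrightarrow> 0 \<le> w y" "0 < r" "(\<Sum>y\<in>C. w y) \<le> r * s"
  shows "card {y \<in> C. r < w y} \<le> s"
proof -
  have "r * card {y \<in> C. r < w y} = (\<Sum>y\<in>{y \<in> C. r < w y}. r)"
    by simp
  also have "\<dots> \<le> (\<Sum>y\<in>{y \<in> C. r < w y}. w y)"
    by (intro sum_mono) auto
  also have "\<dots> \<le> (\<Sum>y\<in>C. w y)"
    using assms by (intro sum_mono2) auto
  also have "\<dots> \<le> r * s" by fact
  finally show ?thesis using assms(3) by simp
qed

text \<open>Markov's inequality at n / (n - 1) times the mean removes at most the fraction (n - 1) /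
  n. So high a loss of vertices is accepted because the threshold can then be repeated n - 1 times
  at bounded total cost, see \<open>compound_growth_le_3\<close>; a factor 2 per step would be
  exponential.\<close>

lemma prune:
  fixes w :: "'b \<Rightarrow> real" and n :: nat
  assumes "finite C" "\<And>y. y \<in> C \<Longrightarrow> 0 \<le> w y" "2 \<le> n"
  shows "card C \<le> n * card {y \<in> C. w y \<le> n / (n - 1) * ((\<Sum>y\<in>C. w y) / card C)}"
proof -
  let ?s = "\<Sum>y\<in>C. w y"
  define r where "r = n / (n - 1) * (?s / card C)"
  let ?g = "card {y \<in> C. w y \<le> r}" and ?b = "card {y \<in> C. r < w y}"
  have s0: "0 \<le> ?s" using assms by (intro sum_nonneg)
  have split: "card C = ?g + ?b"
  proof -
    have "C = {y \<in> C. w y \<le> r} \<union> {y \<in> C. r < w y}" by auto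
    then show ?thesis
      using assms(1) by (metis (no_types, lifting) card_Un_disjoint disjoint_iff finite_Un
          mem_Collect_eq not_less)
  qed
  have n1: "real (n - 1) = real n - 1" "real n - 1 > 0" using assms(3) by (auto simp: of_nat_diff)
  have "card C \<le> n * ?g"
  \<comment> \<open>Markov's inequality needs a positive threshold, so total weight 0 is treated
    apart.\<close>
  proof (cases "?s = 0")
    case True
    then have "w y = 0" if "y \<in> C" for y
      using that assms(1,2) by (simp add: sum_nonneg_eq_0_iff)
    then have "{y \<in> C. w y \<le> r} = C" using True by (auto simp: r_def)
    then show ?thesis using assms(3) by simp
  next
    case False
    then have sp: "0 < ?s" using s0 by simp
    then have cp: "0 < card C" using assms(1) by (auto simp: card_gt_0_iff)
    then have rp: "0 < r" using sp n1 assms(3) unfolding r_def by simp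
    have "?s \<le> r * (card C * ((n - 1) / n))"
      using cp n1 assms(3) unfolding r_def by (simp add: field_simps)
    then have "real ?b \<le> card C * ((n - 1) / n)"
      using markov_card[of C w r "card C * (real (n - 1) / n)"] assms(1,2) rp by simp
    then have "real n * ?b \<le> card C * (real n - 1)"
      using n1 assms(3) by (simp add: field_simps)
    then have "real (card C) \<le> n * ?g"
      unfolding split using n1 by (simp add: algebra_simps)
    then show ?thesis by (metis of_nat_le_iff of_nat_mult)
  qed
  then show ?thesis unfolding r_def .
qed

lemma compound_growth_le_3:
  fixes n :: nat
  assumes "2 \<le> n" "t \<le> n - 1"
  shows "(n / real (n - 1)) ^ t \<le> 3"
proof -
  have n1: "real (n - 1) = real n - 1" "real n - 1 > 0" using assms(1) by (auto simp: of_nat_diff)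
  have "n / real (n - 1) = 1 + 1 / real (n - 1)"
    using n1 by (simp add: field_simps)
  also have "\<dots> \<le> exp (1 / real (n - 1))"
    by (rule exp_ge_add_one_self)
  finally have "(n / real (n - 1)) ^ (n - 1) \<le> exp (1 / real (n - 1)) ^ (n - 1)"
    by (intro power_mono) auto
  also have "\<dots> = exp 1"
    using n1 by (simp flip: exp_of_nat_mult)
  also have "\<dots> \<le> 3" by (rule exp_le)
  finally have "(n / real (n - 1)) ^ (n - 1) \<le> 3" .
  moreover have "(n / real (n - 1)) ^ t \<le> (n / real (n - 1)) ^ (n - 1)"
    using assms(2) n1 by (intro power_increasing) auto
  ultimately show ?thesis by linarith
qed

section \<open>Greedy embedding in one colour\<close>

text \<open>\<open>G\<close> is the colour in which the pattern is embedded, \<beta> the weight of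
  the old colours. In the last bound on \<rho>, n ^ 2 counts the ordered pairs in the potential, 3
  bounds the accumulated growth, 2 * n makes room for Markov's inequality in
  \<open>sparse_pair_exists\<close>, and the power of \<epsilon> / n pays for the common neighbours
  of an edge.\<close>

locale greedy_embedding =
  fixes n d p :: nat and adj :: "nat \<Rightarrow> nat \<Rightarrow> bool" and X :: "nat \<Rightarrow> 'b set"
    and G :: "'b \<Rightarrow> 'b \<Rightarrow> bool" and \<beta> :: "'b \<Rightarrow> 'b \<Rightarrow> real" and \<epsilon> \<rho> :: real
  assumes n: "2 \<le> n"
    and adj_commute: "adj i j = adj j i"
    and adj_irrefl: "\<not> adj i i"
    and back_degree: "j \<in> {1..n} \<Longrightarrow> card {i \<in> {1..<j}. adj i j} \<le> d"
    and back_codegree: "1 \<le> i \<Longrightarrow> i < j \<Longrightarrow> j \<le> n \<Longrightarrow> adj i j \<Longrightarrow>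
           card {k \<in> {1..<i}. adj k i \<and> adj k j} \<le> p - 1"
    and finite_X: "i \<in> {1..n} \<Longrightarrow> finite (X i)"
    and X_nonempty: "i \<in> {1..n} \<Longrightarrow> X i \<noteq> {}"
    and \<beta>_nonneg: "0 \<le> \<beta> x y"
    and \<beta>_commute: "\<beta> x y = \<beta> y x"
    and \<epsilon>: "0 < \<epsilon>" "\<epsilon> \<le> 1"
    and dens_X: "i \<in> {1..n} \<Longrightarrow> j \<in> {1..n} \<Longrightarrow> adj i j \<Longrightarrow> dens \<beta> (X i) (X j) \<le> \<rho>"
    and \<rho>: "0 \<le> \<rho>" "6 * n ^ 3 * \<rho> \<le> \<epsilon> * (\<epsilon> / n) ^ (p - 1)"
begin

text \<open>One step keeps at least a fraction 1 / n of a candidate set when pruning, and then at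
  least a fraction \<epsilon> when passing to neighbours.\<close>

abbreviation \<eta> :: real where "\<eta> \<equiv> \<epsilon> / n"

abbreviation growth :: real where "growth \<equiv> n / real (n - 1)"

definition earlier :: "nat \<Rightarrow> nat \<Rightarrow> nat set" where
  "earlier t j = {i \<in> {1..<t}. adj i j}"

definition common :: "nat \<Rightarrow> nat \<Rightarrow> nat \<Rightarrow> nat set" where
  "common t j k = {i \<in> {1..<t}. adj i j \<and> adj i k}"

text \<open>A density may rise by 1 / \<eta> when both sets of an edge shrink at once, that is, once
  per common embedded neighbour. The power of \<eta> cancels exactly this rise.\<close>

definition wt :: "nat \<Rightarrow> nat \<Rightarrow> nat \<Rightarrow> real" where
  "wt t j k = (if adj j k then \<eta> ^ card (common t j k) else 0)"

definition potential :: "nat \<Rightarrow> (nat \<Rightarrow> 'b set) \<Rightarrow> real" where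
  "potential t C = (\<Sum>j\<in>{t..n}. \<Sum>k\<in>{t..n}. wt t j k * dens \<beta> (C j) (C k))"

text \<open>The vertices of index below \<open>t\<close> are embedded by \<open>x\<close>, and \<open>C j\<close> is the set of candidates for
  the vertex \<open>j \<ge> t\<close>.\<close>

definition partial_embedding :: "nat \<Rightarrow> (nat \<Rightarrow> 'b) \<Rightarrow> (nat \<Rightarrow> 'b set) \<Rightarrow> bool" where
  "partial_embedding t x C \<longleftrightarrow>
     (\<forall>j\<in>{t..n}. C j \<subseteq> X j \<and> \<eta> ^ card (earlier t j) * card (X j) \<le> card (C j) \<and>
        (\<forall>i\<in>earlier t j. \<forall>y\<in>C j. G (x i) y)) \<and>
     (\<forall>i\<in>{1..<t}. x i \<in> X i) \<and>
     (\<forall>i j. 1 \<le> i \<and> i < j \<and> j < t \<and> adj i j \<longrightarrow> G (x i) (x j)) \<and>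
     potential t C \<le> growth ^ (t - 1) * (n\<^sup>2 * \<rho>)"

text \<open>The bound on \<open>A\<close> is weaker by 2 * n: \<open>A\<close> is what remains of
  the candidates for one vertex after a pigeonhole argument (factor n) and Markov's inequality
  (factor 2).\<close>

definition sparse_pair :: "nat \<Rightarrow> nat \<Rightarrow> 'b set \<Rightarrow> 'b set \<Rightarrow> bool" where
  "sparse_pair i j A D \<longleftrightarrow> A \<subseteq> X i \<and> D \<subseteq> X j \<and>
     \<eta> ^ d * card (X i) \<le> 2 * n * card A \<and> \<eta> ^ d * card (X j) \<le> card D \<and>
     (\<forall>a\<in>A. avdeg (\<lambda>x y. \<beta> x y + of_bool (G x y)) a D \<le> 2 * \<epsilon>)"

section \<open>Counting earlier and common neighbours\<close>

lemma \<eta>: "0 < \<eta>" "\<eta> \<le> 1" "\<eta> \<le> 1 / n"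
  using \<epsilon> n by (auto simp: field_simps)

lemma growth_ge_1: "1 \<le> growth"
  using n by (simp add: field_simps)

lemma wt_nonneg: "0 \<le> wt t j k"
  using \<eta> by (simp add: wt_def)

lemma common_commute: "common t j k = common t k j"
  by (auto simp: common_def)

lemma wt_commute: "wt t j k = wt t k j"
  by (simp add: wt_def common_commute[of t j k] adj_commute[of j k])

lemma card_earlier_le: "j \<in> {t..n} \<Longrightarrow> 1 \<le> t \<Longrightarrow> card (earlier t j) \<le> d"
  using back_degree[of j]
    card_mono[of "{i \<in> {1..<j}. adj i j}" "earlier t j"] by (force simp: earlier_def)

lemma card_earlier_Suc:
  assumes "1 \<le> t"
  shows "card (earlier (Suc t) j) = (if adj t j then Suc (card (earlier t j)) else card (earlier t j))"
proof -
  have "earlier (Suc t) j = (if adj t j then insert t (earlier t j) else earlier t j)"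
    using assms by (auto simp: earlier_def less_Suc_eq)
  then show ?thesis
    by (simp add: earlier_def)
qed

lemma card_common_Suc:
  assumes "1 \<le> t"
  shows "card (common (Suc t) j k) =
    (if adj t j \<and> adj t k then Suc (card (common t j k)) else card (common t j k))"
proof -
  have "common (Suc t) j k = (if adj t j \<and> adj t k then insert t (common t j k) else common t j k)"
    using assms by (auto simp: common_def less_Suc_eq)
  moreover have "finite (common t j k)" "t \<notin> common t j k"
    by (auto simp: common_def)
  ultimately show ?thesis by simp
qed

lemma wt_Suc:
  assumes "1 \<le> t"
  shows "wt (Suc t) j k = (if adj t j \<and> adj t k then \<eta> * wt t j k else wt t j k)"
  using card_common_Suc[OF assms] by (simp add: wt_def)

text \<open>The vertices in \<open>common t t j\<close> all precede t, the smaller end of the edge,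
  so they are counted by the codegree hypothesis.\<close>

lemma wt_ge:
  assumes "1 \<le> t" "t < j" "j \<le> n" "adj t j"
  shows "\<eta> ^ (p - 1) \<le> wt t t j"
proof -
  have "card (common t t j) \<le> p - 1"
    using back_codegree[OF assms] by (simp add: common_def)
  then show ?thesis
    using assms(4) \<eta> by (simp add: wt_def power_decreasing)
qed

lemma candidates_pos:
  assumes "partial_embedding t x C" "1 \<le> t" "j \<in> {t..n}"
  shows "0 < card (C j)" "finite (C j)"
proof -
  have j: "j \<in> {1..n}" using assms by simp
  have sub: "C j \<subseteq> X j" and le: "\<eta> ^ card (earlier t j) * card (X j) \<le> card (C j)"
    using assms by (auto simp: partial_embedding_def)
  have "0 < card (X j)" using finite_X[OF j] X_nonempty[OF j] by (simp add: card_gt_0_iff)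
  then have "0 < \<eta> ^ card (earlier t j) * card (X j)" using \<eta> by simp
  then show "0 < card (C j)" using le by linarith
  show "finite (C j)" using finite_subset[OF sub finite_X[OF j]] .
qed

lemma initial_embedding: "partial_embedding 1 x X"
proof -
  have w: "wt 1 j k * dens \<beta> (X j) (X k) \<le> \<rho>" if "j \<in> {1..n}" "k \<in> {1..n}" for j k
    using dens_X[OF that] \<rho>(1) by (simp add: wt_def common_def)
  have "potential 1 X \<le> (\<Sum>j\<in>{1..n}. \<Sum>k\<in>{1..n}. \<rho>)"
    unfolding potential_def by (intro sum_mono w)
  also have "\<dots> = n\<^sup>2 * \<rho>" by (simp add: power2_eq_square)
  finally show ?thesis
    by (simp add: partial_embedding_def earlier_def)
qed

section \<open>Pruning and the growth of the potential in one step\<close>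

definition later :: "nat \<Rightarrow> nat set" where
  "later t = {j \<in> {Suc t..n}. adj t j}"

text \<open>Each edge of the potential is charged to its ends, with shares adding up to \<open>1\<close>, so that an edge
  having exactly one end in \<open>later t\<close> is charged to that end only.\<close>

definition share :: "nat \<Rightarrow> nat \<Rightarrow> nat \<Rightarrow> real" where
  "share t j k = (if (j \<in> later t) = (k \<in> later t) then 1 / 2 else if j \<in> later t then 1 else 0)"

text \<open>The part of the potential charged to j, localised at one candidate y. Its average over
  \<open>C j\<close> is \<open>mean_load\<close>, so \<open>prune\<close> applies to it.\<close>

definition load :: "nat \<Rightarrow> (nat \<Rightarrow> 'b set) \<Rightarrow> nat \<Rightarrow> 'b \<Rightarrow> real" where
  "load t C j y = (\<Sum>k\<in>{t..n}. share t j k * (wt t j k * avdeg \<beta> y (C k)))"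

definition mean_load :: "nat \<Rightarrow> (nat \<Rightarrow> 'b set) \<Rightarrow> nat \<Rightarrow> real" where
  "mean_load t C j = (\<Sum>k\<in>{t..n}. share t j k * (wt t j k * dens \<beta> (C j) (C k)))"

definition pruned :: "nat \<Rightarrow> (nat \<Rightarrow> 'b set) \<Rightarrow> nat \<Rightarrow> 'b set" where
  "pruned t C j = {y \<in> C j. load t C j y \<le> growth * mean_load t C j}"

lemma share_nonneg: "0 \<le> share t j k"
  by (simp add: share_def)

lemma share_le_1: "share t j k \<le> 1"
  by (simp add: share_def)

lemma share_sum: "share t j k + share t k j = 1"
  by (simp add: share_def)

lemma avdeg_beta_nonneg: "0 \<le> avdeg \<beta> x A"
  using \<beta>_nonneg by (rule avdeg_nonneg)

lemma dens_beta_nonneg: "0 \<le> dens \<beta> A B"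
  using \<beta>_nonneg by (rule dens_nonneg)

lemma dens_beta_commute: "dens \<beta> A B = dens \<beta> B A"
  using \<beta>_commute by (rule dens_commute)

lemma load_nonneg: "0 \<le> load t C j y"
  unfolding load_def by (intro sum_nonneg mult_nonneg_nonneg share_nonneg wt_nonneg avdeg_beta_nonneg)

lemma mean_load_nonneg: "0 \<le> mean_load t C j"
  unfolding mean_load_def
  by (intro sum_nonneg mult_nonneg_nonneg share_nonneg wt_nonneg dens_beta_nonneg)

lemma average_weighted_avdeg:
  "(\<Sum>y\<in>A. \<Sum>k\<in>K. c k * (w k * avdeg \<beta> y (C k))) / card A = (\<Sum>k\<in>K. c k * (w k * dens \<beta> A (C k)))"
  unfolding dens_def by (subst sum.swap) (simp add: sum_divide_distrib sum_distrib_left)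

lemma mean_load_eq: "mean_load t C j = (\<Sum>y\<in>C j. load t C j y) / card (C j)"
  unfolding mean_load_def load_def average_weighted_avdeg ..

text \<open>Weights and densities are symmetric, so exchanging the two summations exchanges the two
  shares of an edge, and these add up to 1.\<close>

lemma potential_share:
  assumes "finite T"
  shows "(\<Sum>j\<in>T. \<Sum>k\<in>T. wt s j k * dens \<beta> (C j) (C k)) =
    2 * (\<Sum>j\<in>T. \<Sum>k\<in>T. share t j k * (wt s j k * dens \<beta> (C j) (C k)))"
proof -
  let ?W = "\<lambda>j k. wt s j k * dens \<beta> (C j) (C k)"
  have W: "?W k j = ?W j k" for j k
    using wt_commute[of s k j] dens_beta_commute[of "C k" "C j"] by simp
  have "(\<Sum>j\<in>T. \<Sum>k\<in>T. ?W j k) = (\<Sum>j\<in>T. \<Sum>k\<in>T. (share t j k + share t k j) * ?W j k)"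
    by (simp add: share_sum)
  also have "\<dots> = (\<Sum>j\<in>T. \<Sum>k\<in>T. share t j k * ?W j k) + (\<Sum>j\<in>T. \<Sum>k\<in>T. share t k j * ?W j k)"
    by (simp add: distrib_right sum.distrib)
  also have "(\<Sum>j\<in>T. \<Sum>k\<in>T. share t k j * ?W j k) = (\<Sum>j\<in>T. \<Sum>k\<in>T. share t j k * ?W j k)"
    by (subst sum.swap) (simp only: W)
  finally show ?thesis by simp
qed

lemma mean_load_le_potential:
  assumes "j \<in> {t..n}"
  shows "mean_load t C j \<le> potential t C"
proof -
  have "mean_load t C j \<le> (\<Sum>k\<in>{t..n}. wt t j k * dens \<beta> (C j) (C k))"
    unfolding mean_load_def
    by (intro sum_mono mult_left_le_one_le mult_nonneg_nonneg wt_nonneg dens_beta_nonneg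
        share_nonneg share_le_1)
  also have "\<dots> \<le> potential t C"
    unfolding potential_def using assms
    by (intro member_le_sum sum_nonneg mult_nonneg_nonneg wt_nonneg dens_beta_nonneg) auto
  finally show ?thesis .
qed

lemma card_pruned:
  assumes "finite (C j)"
  shows "card (C j) \<le> n * card (pruned t C j)"
  using prune[of "C j" "load t C j" n] assms load_nonneg n by (simp add: pruned_def mean_load_eq)

text \<open>Once the potential is rewritten with shares, rows can be compared. A row outside
  \<open>later t\<close> has share 0 towards every set that changes. In a row inside, pruning bounds
  the load of each surviving y, and the rise by 1 / \<eta> from shrinking the second set is absorbed
  by the new factor \<eta> in \<open>wt\<close>.\<close>

lemma potential_Suc_le:
  assumes "1 \<le> t"
    and pos: "\<And>j. j \<in> {t..n} \<Longrightarrow> finite (C j) \<and> 0 < card (C j)"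
    and same: "\<And>j. j \<notin> later t \<Longrightarrow> C' j = C j"
    and shrunk: "\<And>j. j \<in> later t \<Longrightarrow> C' j \<subseteq> pruned t C j"
    and large: "\<And>j. j \<in> later t \<Longrightarrow> \<eta> * card (C j) \<le> card (C' j)"
  shows "potential (Suc t) C' \<le> growth * potential t C"
proof -
  have later_adj: "j \<in> {Suc t..n} \<Longrightarrow> adj t j \<longleftrightarrow> j \<in> later t" for j
    by (auto simp: later_def)
  have main: "(\<Sum>k\<in>{Suc t..n}. share t j k * (wt (Suc t) j k * dens \<beta> (C' j) (C' k)))
      \<le> growth * mean_load t C j" if j: "j \<in> {Suc t..n}" for j
  proof (cases "j \<in> later t")
    case False
    then have "(\<Sum>k\<in>{Suc t..n}. share t j k * (wt (Suc t) j k * dens \<beta> (C' j) (C' k))) =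
      (\<Sum>k\<in>{Suc t..n}. share t j k * (wt t j k * dens \<beta> (C j) (C k)))"
      using later_adj[OF j] same wt_Suc[OF assms(1)]
      by (intro sum.cong refl) (simp add: share_def)
    also have "\<dots> \<le> mean_load t C j"
      unfolding mean_load_def
      by (intro sum_mono2 mult_nonneg_nonneg share_nonneg wt_nonneg dens_beta_nonneg) auto
    also have "\<dots> \<le> growth * mean_load t C j"
      using mult_right_mono[OF growth_ge_1 mean_load_nonneg] by simp
    finally show ?thesis .
  next
    case True
    have le: "wt (Suc t) j k * avdeg \<beta> y (C' k) \<le> wt t j k * avdeg \<beta> y (C k)"
      if k: "k \<in> {Suc t..n}" for k y
    proof (cases "k \<in> later t")
      case False
      then show ?thesis
        using later_adj[OF k] same wt_Suc[OF assms(1)] by simp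
    next
      case T: True
      have "finite (C k)" using pos[of k] k by simp
      moreover have "C' k \<subseteq> C k" using shrunk[OF T] by (auto simp: pruned_def)
      ultimately have "\<eta> * avdeg \<beta> y (C' k) \<le> avdeg \<beta> y (C k)"
        by (intro avdeg_subset \<beta>_nonneg large T \<eta>)
      then have "wt t j k * (\<eta> * avdeg \<beta> y (C' k)) \<le> wt t j k * avdeg \<beta> y (C k)"
        by (intro mult_left_mono wt_nonneg)
      then show ?thesis
        using wt_Suc[OF assms(1), of j k] True T by (simp add: later_def mult_ac)
    qed
    have "(\<Sum>k\<in>{Suc t..n}. share t j k * (wt (Suc t) j k * avdeg \<beta> y (C' k))) \<le> growth * mean_load t C j"
      if y: "y \<in> C' j" for y
    proof -
      have "(\<Sum>k\<in>{Suc t..n}. share t j k * (wt (Suc t) j k * avdeg \<beta> y (C' k)))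
        \<le> (\<Sum>k\<in>{Suc t..n}. share t j k * (wt t j k * avdeg \<beta> y (C k)))"
        by (intro sum_mono mult_left_mono le share_nonneg)
      also have "\<dots> \<le> load t C j y"
        unfolding load_def
        by (intro sum_mono2 mult_nonneg_nonneg share_nonneg wt_nonneg avdeg_beta_nonneg) auto
      also have "\<dots> \<le> growth * mean_load t C j"
        using y shrunk[OF True] by (auto simp: pruned_def)
      finally show ?thesis .
    qed
    then have "(\<Sum>y\<in>C' j. \<Sum>k\<in>{Suc t..n}. share t j k * (wt (Suc t) j k * avdeg \<beta> y (C' k)))
        \<le> card (C' j) * (growth * mean_load t C j)"
      by (rule sum_bounded_above)
    moreover have "0 < card (C' j)"
      using large[OF True] pos[of j] j \<eta>(1)
      by (metis atLeastAtMost_iff Suc_leD mult_pos_pos of_nat_0_less_iff order_less_le_trans)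
    ultimately show ?thesis
      unfolding average_weighted_avdeg[symmetric] by (simp add: field_simps)
  qed
  have "potential (Suc t) C' \<le> 2 * (\<Sum>j\<in>{Suc t..n}. growth * mean_load t C j)"
    unfolding potential_def potential_share[OF finite_atLeastAtMost, where t = t]
    by (intro mult_left_mono sum_mono main) auto
  also have "\<dots> \<le> 2 * (\<Sum>j\<in>{t..n}. growth * mean_load t C j)"
    using growth_ge_1 mean_load_nonneg by (intro mult_left_mono sum_mono2 mult_nonneg_nonneg) auto
  also have "\<dots> = growth * potential t C"
    unfolding potential_def potential_share[OF finite_atLeastAtMost, where t = t] mean_load_def
    by (simp add: sum_distrib_left mult_ac)
  finally show ?thesis .
qed

text \<open>Pruning and then passing to the neighbours of a leaves at least the fraction \<eta> of
  each set in \<open>later t\<close>, so \<open>potential_Suc_le\<close> applies. Sets of vertices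
  not adjacent to t stay as they are, which keeps their size bound free of a further factor.\<close>

lemma embedding_step:
  assumes "1 \<le> t" "t \<le> n" and emb: "partial_embedding t x C"
    and a: "a \<in> C t"
    and many: "\<And>j. j \<in> later t \<Longrightarrow>
      \<epsilon> * card (pruned t C j) \<le> card {y \<in> pruned t C j. G a y}"
  shows "partial_embedding (Suc t) (x(t := a))
    (\<lambda>j. if j \<in> later t then {y \<in> pruned t C j. G a y} else C j)"
    (is "partial_embedding _ ?x ?C")
proof -
  have C: "C j \<subseteq> X j" "\<eta> ^ card (earlier t j) * card (X j) \<le> card (C j)"
    "i \<in> earlier t j \<Longrightarrow> y \<in> C j \<Longrightarrow> G (x i) y" if "j \<in> {t..n}" for i j y
    using emb that by (auto simp: partial_embedding_def)
  have x: "i \<in> {1..<t} \<Longrightarrow> x i \<in> X i"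
    "1 \<le> i \<Longrightarrow> i < j \<Longrightarrow> j < t \<Longrightarrow> adj i j \<Longrightarrow> G (x i) (x j)" for i j
    using emb by (auto simp: partial_embedding_def)
  have pos: "finite (C j) \<and> 0 < card (C j)" if "j \<in> {t..n}" for j
    using candidates_pos[OF emb assms(1) that] by simp
  have pot: "potential t C \<le> growth ^ (t - 1) * (n\<^sup>2 * \<rho>)"
    using emb by (simp add: partial_embedding_def)
  have large: "\<eta> * card (C j) \<le> card {y \<in> pruned t C j. G a y}" if j: "j \<in> later t" for j
  proof -
    have "finite (C j)" using pos j by (auto simp: later_def)
    then have "real (card (C j)) \<le> n * card (pruned t C j)"
      by (metis card_pruned of_nat_le_iff of_nat_mult)
    then have "\<eta> * card (C j) \<le> \<eta> * (n * card (pruned t C j))"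
      using \<eta>(1) by (intro mult_left_mono) auto
    also have "\<dots> = \<epsilon> * card (pruned t C j)"
      using n by simp
    also have "\<dots> \<le> card {y \<in> pruned t C j. G a y}"
      by (rule many[OF j])
    finally show ?thesis .
  qed
  have sub: "?C j \<subseteq> C j" for j by (auto simp: pruned_def)
  have "potential (Suc t) ?C \<le> growth * potential t C"
    using pos large by (intro potential_Suc_le assms(1)) auto
  also have "\<dots> \<le> growth * (growth ^ (t - 1) * (n\<^sup>2 * \<rho>))"
    using pot growth_ge_1 by (intro mult_left_mono) auto
  also have "\<dots> = growth ^ (Suc t - 1) * (n\<^sup>2 * \<rho>)"
    using assms(1) by (cases t) auto
  finally have pot': "potential (Suc t) ?C \<le> growth ^ (Suc t - 1) * (n\<^sup>2 * \<rho>)" .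
  have "?C j \<subseteq> X j \<and> \<eta> ^ card (earlier (Suc t) j) * card (X j) \<le> card (?C j) \<and>
    (\<forall>i\<in>earlier (Suc t) j. \<forall>y\<in>?C j. G (?x i) y)" if j: "j \<in> {Suc t..n}" for j
  proof (intro conjI ballI)
    have jt: "j \<in> {t..n}" using j by simp
    have adj: "adj t j \<longleftrightarrow> j \<in> later t" using j by (simp add: later_def)
    show "?C j \<subseteq> X j" using sub C(1)[OF jt] by blast
    show "\<eta> ^ card (earlier (Suc t) j) * card (X j) \<le> card (?C j)"
    proof (cases "j \<in> later t")
      case True
      have "\<eta> * (\<eta> ^ card (earlier t j) * card (X j)) \<le> \<eta> * card (C j)"
        using C(2)[OF jt] \<eta>(1) by (intro mult_left_mono) auto
      then show ?thesis
        using large[OF True] True adj card_earlier_Suc[OF assms(1)] by (simp add: mult_ac)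
    next
      case False
      then show ?thesis using C(2)[OF jt] adj card_earlier_Suc[OF assms(1)] by simp
    qed
    fix i y assume i: "i \<in> earlier (Suc t) j" and y: "y \<in> ?C j"
    show "G (?x i) y"
    proof (cases "i = t")
      case True
      then have "j \<in> later t" using i adj by (simp add: earlier_def)
      then show ?thesis using y True by simp
    next
      case False
      then have "i \<in> earlier t j" using i by (auto simp: earlier_def)
      then show ?thesis using C(3)[OF jt, of i y] subsetD[OF sub y] False by simp
    qed
  qed
  moreover have "?x i \<in> X i" if "i \<in> {1..<Suc t}" for i
    using that x(1)[of i] a C(1)[of t] assms(2) by (cases "i = t") auto
  moreover have "G (?x i) (?x j)" if "1 \<le> i" "i < j" "j < Suc t" "adj i j" for i j
  proof (cases "j = t")
    case True
    then have "i \<in> earlier t t" using that by (simp add: earlier_def)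
    then show ?thesis using C(3)[of t i a] a True that assms(2) by simp
  next
    case False
    then show ?thesis using that x(2)[of i j] by simp
  qed
  ultimately show ?thesis
    using pot' by (simp add: partial_embedding_def)
qed

text \<open>Every candidate for t is defeated by some j, hence one j defeats a large part of them,
  and \<open>D\<close> is the pruned set of this j. Pruning makes the old colours sparse from each
  point of \<open>D\<close> to \<open>C t\<close>; double counting turns this around, and Markov's
  inequality discards the few candidates for t that are heavy in the old colours.\<close>

lemma sparse_pair_exists:
  assumes "1 \<le> t" "t \<le> n" and emb: "partial_embedding t x C"
    and few: "\<And>a. a \<in> C t \<Longrightarrow>
      \<exists>j\<in>later t. card {y \<in> pruned t C j. G a y} < \<epsilon> * card (pruned t C j)"
  shows "\<exists>i j A D. i \<in> {1..n} \<and> j \<in> {1..n} \<and> i \<noteq> j \<and> sparse_pair i j A D"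
proof -
  have C: "C j \<subseteq> X j" "\<eta> ^ card (earlier t j) * card (X j) \<le> card (C j)" if "j \<in> {t..n}" for j
    using emb that by (auto simp: partial_embedding_def)
  have t: "t \<in> {t..n}" using assms by simp
  note Ct = candidates_pos[OF emb assms(1) t]
  define F where "F j = {a \<in> C t. card {y \<in> pruned t C j. G a y} < \<epsilon> * card (pruned t C j)}" for j
  have cover: "C t \<subseteq> (\<Union>j\<in>later t. F j)"
    using few by (auto simp: F_def)
  \<comment> \<open>Pigeonhole: at most n sets \<open>F j\<close> cover \<open>C t\<close>.\<close>
  have "\<exists>j\<in>later t. card (C t) \<le> n * card (F j)"
  proof (rule ccontr)
    assume "\<not> ?thesis"
    then have lt: "n * card (F j) < card (C t)" if "j \<in> later t" for j
      using that by (simp add: not_le)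
    have ne: "later t \<noteq> {}" using cover Ct by auto
    have fin: "finite (later t)" by (simp add: later_def)
    have "n * card (C t) \<le> n * card (\<Union>j\<in>later t. F j)"
      using fin Ct(2) cover by (intro mult_left_mono card_mono) (auto simp: F_def)
    also have "\<dots> \<le> n * (\<Sum>j\<in>later t. card (F j))"
      by (intro mult_left_mono card_UN_le fin) auto
    also have "\<dots> = (\<Sum>j\<in>later t. n * card (F j))" by (simp add: sum_distrib_left)
    also have "\<dots> < (\<Sum>j\<in>later t. card (C t))"
      using lt fin ne by (intro sum_strict_mono) auto
    also have "\<dots> = card (later t) * card (C t)" by simp
    also have "card (later t) \<le> n"
    proof -
      have "later t \<subseteq> {1..n}" by (auto simp: later_def)
      then show ?thesis using card_mono[of "{1..n}" "later t"] by simp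
    qed
    finally show False by simp
  qed
  then obtain j where j: "j \<in> later t" and F: "card (C t) \<le> n * card (F j)" by blast
  have jr: "j \<in> {t..n}" "t < j" "j \<le> n" "adj t j" using j by (auto simp: later_def)
  note Cj = candidates_pos[OF emb assms(1) jr(1)]
  define D where "D = pruned t C j"
  have D: "D \<subseteq> C j" "card (C j) \<le> n * card D"
    using card_pruned Cj by (auto simp: D_def pruned_def)
  have small: "\<eta> ^ (p - 1) * avdeg \<beta> y (C t) \<le> 3 * n\<^sup>2 * \<rho>" if y: "y \<in> D" for y
  proof -
    have "\<eta> ^ (p - 1) * avdeg \<beta> y (C t) \<le> wt t j t * avdeg \<beta> y (C t)"
      using wt_ge[OF assms(1) jr(2-4)] wt_commute[of t j t]
      by (intro mult_right_mono avdeg_beta_nonneg) auto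
    \<comment> \<open>Here j lies in \<open>later t\<close> and t does not, so the edge is charged
      to j with share 1 and is a term of the load that pruning controls.\<close>
    also have "\<dots> = share t j t * (wt t j t * avdeg \<beta> y (C t))"
      using j by (simp add: share_def) (simp add: later_def)
    also have "\<dots> \<le> load t C j y"
      unfolding load_def using t
      by (intro member_le_sum[of t _ "\<lambda>k. share t j k * (wt t j k * avdeg \<beta> y (C k))"]
          mult_nonneg_nonneg share_nonneg wt_nonneg avdeg_beta_nonneg) auto
    also have "\<dots> \<le> growth * mean_load t C j"
      using y by (simp add: D_def pruned_def)
    also have "\<dots> \<le> growth * (growth ^ (t - 1) * (n\<^sup>2 * \<rho>))"
      using mean_load_le_potential[OF jr(1), of C] emb growth_ge_1
      by (intro mult_left_mono) (auto simp: partial_embedding_def)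
    also have "\<dots> = growth ^ t * (n\<^sup>2 * \<rho>)"
      using assms(1) by (cases t) auto
    \<comment> \<open>Since t < j \<le> n, at most n - 1 factors \<open>growth\<close> have
      accumulated.\<close>
    also have "\<dots> \<le> 3 * (n\<^sup>2 * \<rho>)"
      using jr(2,3) \<rho>(1) by (intro mult_right_mono compound_growth_le_3 n) auto
    finally show ?thesis by simp
  qed
  have small': "avdeg \<beta> y (C t) \<le> \<epsilon> / (2 * n)" if y: "y \<in> D" for y
  proof -
    have "\<eta> ^ (p - 1) * (2 * n * avdeg \<beta> y (C t)) \<le> 6 * n ^ 3 * \<rho>"
      using mult_left_mono[OF small[OF y], of "2 * n"] by (simp add: power3_eq_cube power2_eq_square mult_ac)
    also have "\<dots> \<le> \<eta> ^ (p - 1) * \<epsilon>" using \<rho>(2) by (simp add: mult.commute)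
    finally have "2 * n * avdeg \<beta> y (C t) \<le> \<epsilon>" using \<eta>(1) by simp
    then show ?thesis using n by (simp add: field_simps)
  qed
  have "dens \<beta> (C t) D \<le> \<epsilon> / (2 * n)"
    using dens_le[of D \<beta> "C t", OF small'] \<epsilon> dens_beta_commute[of "C t" D] by simp
  then have tot: "(\<Sum>a\<in>C t. avdeg \<beta> a D) \<le> \<epsilon> * (card (C t) / (2 * n))"
    using Ct(1) by (simp add: dens_def field_simps)
  \<comment> \<open>At most half of the guaranteed 1 / n fraction \<open>F j\<close> is lost here;
    the rest becomes \<open>A\<close>.\<close>
  have heavy: "card {a \<in> C t. \<epsilon> < avdeg \<beta> a D} \<le> card (C t) / (2 * n)"
    by (rule markov_card[OF Ct(2) avdeg_beta_nonneg \<epsilon>(1) tot])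
  define A where "A = {a \<in> F j. avdeg \<beta> a D \<le> \<epsilon>}"
  have "F j \<subseteq> A \<union> {a \<in> C t. \<epsilon> < avdeg \<beta> a D}"
    by (auto simp: A_def F_def)
  then have "card (F j) \<le> card (A \<union> {a \<in> C t. \<epsilon> < avdeg \<beta> a D})"
    using Ct(2) by (intro card_mono) (auto simp: A_def F_def)
  also have "\<dots> \<le> card A + card {a \<in> C t. \<epsilon> < avdeg \<beta> a D}"
    by (rule card_Un_le)
  finally have "real (card (F j)) \<le> card A + card (C t) / (2 * n)"
    using heavy by linarith
  moreover have "real (card (C t)) \<le> n * card (F j)"
    using F by (metis of_nat_le_iff of_nat_mult)
  ultimately have "real (card (C t)) \<le> n * (card A + card (C t) / (2 * n))"
    using mult_left_mono[of "real (card (F j))" "card A + card (C t) / (2 * n)" "real n"] by simp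
  then have "real (card (C t)) \<le> 2 * n * card A"
    using n by (simp add: field_simps)
  moreover have "\<eta> ^ d * card (X t) \<le> \<eta> ^ card (earlier t t) * card (X t)"
    using card_earlier_le[OF t assms(1)] \<eta> by (intro mult_right_mono power_decreasing) auto
  ultimately have cA: "\<eta> ^ d * card (X t) \<le> 2 * n * card A"
    using C(2)[OF t] by linarith
  \<comment> \<open>The vertex t is itself a neighbour of j preceding it and \<open>C j\<close> has
    not yet shrunk because of it. So one factor \<eta> \<le> 1 / n is left to pay for the
    pruning.\<close>
  have "Suc (card (earlier t j)) \<le> d"
    using card_earlier_le[of j "Suc t"] jr card_earlier_Suc[OF assms(1), of j] by simp
  then have "\<eta> ^ d * card (X j) \<le> \<eta> ^ Suc (card (earlier t j)) * card (X j)"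
    using \<eta> by (intro mult_right_mono power_decreasing) auto
  also have "\<dots> \<le> \<eta> * card (C j)"
    unfolding power_Suc mult.assoc using C(2)[OF jr(1)] less_imp_le[OF \<eta>(1)] by (rule mult_left_mono)
  also have "\<dots> \<le> 1 / n * (n * card D)"
    using \<eta> D(2) by (intro mult_mono) (auto simp flip: of_nat_mult)
  also have "\<dots> = card D" using n by simp
  finally have cD: "\<eta> ^ d * card (X j) \<le> card D" .
  have "avdeg (\<lambda>x y. \<beta> x y + of_bool (G x y)) a D \<le> 2 * \<epsilon>" if a: "a \<in> A" for a
  proof -
    have "finite D" using finite_subset[OF D(1) Cj(2)] .
    then have "(\<Sum>y\<in>D. of_bool (G a y)) = real (card {y \<in> D. G a y})"
      by (simp add: of_bool_def sum.If_cases Int_def)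
    moreover have "card {y \<in> D. G a y} \<le> \<epsilon> * card D"
      using a by (simp add: A_def F_def D_def)
    ultimately have "(\<Sum>y\<in>D. of_bool (G a y)) / card D \<le> \<epsilon>"
      using \<epsilon> by (cases "card D = 0") (auto simp: field_simps)
    moreover have "avdeg \<beta> a D \<le> \<epsilon>" using a by (simp add: A_def)
    ultimately show ?thesis
      by (simp add: avdeg_def sum.distrib add_divide_distrib)
  qed
  moreover have "A \<subseteq> X t" "D \<subseteq> X j"
    using C(1)[OF t] C(1)[OF jr(1)] D(1) by (auto simp: A_def F_def)
  ultimately have "sparse_pair t j A D"
    using cA cD unfolding sparse_pair_def by blast
  moreover have "t \<in> {1..n}" "j \<in> {1..n}" "t \<noteq> j"
    using jr assms(1,2) by auto
  ultimately show ?thesis by blast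
qed

theorem embedding_or_sparse_pair:
  assumes G_commute: "\<And>x y. G x y = G y x"
  obtains x where "\<And>i. i \<in> {1..n} \<Longrightarrow> x i \<in> X i"
      "\<And>i j. i \<in> {1..n} \<Longrightarrow> j \<in> {1..n} \<Longrightarrow> adj i j \<Longrightarrow> G (x i) (x j)"
  | i j A D where "i \<in> {1..n}" "j \<in> {1..n}" "i \<noteq> j" "sparse_pair i j A D"
proof (cases "\<exists>i j A D. i \<in> {1..n} \<and> j \<in> {1..n} \<and> i \<noteq> j \<and> sparse_pair i j A D")
  case True
  then show ?thesis using that(2) by blast
next
  case False
  have "\<exists>x C. partial_embedding (Suc t) x C" if "t \<le> n" for t
    using that
  proof (induction t)
    case 0
    show ?case using initial_embedding by auto
  next
    case (Suc t)
    then obtain x C where emb: "partial_embedding (Suc t) x C" by auto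
    have "\<exists>a\<in>C (Suc t). \<forall>j\<in>later (Suc t).
        \<epsilon> * card (pruned (Suc t) C j) \<le> card {y \<in> pruned (Suc t) C j. G a y}"
    proof (rule ccontr)
      assume "\<not> ?thesis"
      then have "\<exists>j\<in>later (Suc t). card {y \<in> pruned (Suc t) C j. G a y}
          < \<epsilon> * card (pruned (Suc t) C j)" if "a \<in> C (Suc t)" for a
        using that by (auto simp: not_le)
      from sparse_pair_exists[OF _ Suc.prems emb this] False show False by simp
    qed
    then obtain a where "a \<in> C (Suc t)" and a: "\<And>j. j \<in> later (Suc t) \<Longrightarrow>
        \<epsilon> * card (pruned (Suc t) C j) \<le> card {y \<in> pruned (Suc t) C j. G a y}"
      by blast
    from embedding_step[OF _ Suc.prems emb this(1) a] show ?case by auto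
  qed
  \<comment> \<open>At index \<open>Suc n\<close> the range of vertices still to be embedded is
    empty.\<close>
  then obtain x C where emb: "partial_embedding (Suc n) x C" by blast
  have lt: "G (x i) (x j)" if "1 \<le> i" "i < j" "j \<le> n" "adj i j" for i j
    using emb that by (simp add: partial_embedding_def)
  have "G (x i) (x j)" if ij: "i \<in> {1..n}" "j \<in> {1..n}" "adj i j" for i j
  proof (cases i j rule: linorder_cases)
    case less
    then show ?thesis using lt ij by simp
  next
    case equal
    then show ?thesis using ij adj_irrefl by simp
  next
    case greater
    then show ?thesis using lt[of j i] ij adj_commute[of i j] G_commute[of "x i" "x j"] by simp
  qed
  moreover have "x i \<in> X i" if "i \<in> {1..n}" for i
    using emb that by (simp add: partial_embedding_def)
  ultimately show ?thesis using that(1) by blast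
qed

end

section \<open>Ordered families of sparse parts\<close>

definition before :: "'b::linorder set \<Rightarrow> 'b set \<Rightarrow> bool"  (infix "\<lless>" 50) where
  "A \<lless> B \<longleftrightarrow> (\<forall>a\<in>A. \<forall>b\<in>B. a < b)"

lemma before_mono: "A \<lless> B \<Longrightarrow> A' \<subseteq> A \<Longrightarrow> B' \<subseteq> B \<Longrightarrow> A' \<lless> B'"
  unfolding before_def by blast

text \<open>The sets are consecutive blocks of length l in the increasing enumeration of X.\<close>

lemma chop:
  fixes X :: "'b::linorder set"
  assumes "finite X" "m * l \<le> card X"
  obtains Z where "\<And>i. i < m \<Longrightarrow> Z i \<subseteq> X" "\<And>i. i < m \<Longrightarrow> card (Z i) = l"
    "\<And>i j. i < j \<Longrightarrow> j < m \<Longrightarrow> Z i \<lless> Z j"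
proof -
  define xs where "xs = sorted_list_of_set X"
  define Z where "Z i = (!) xs ` {i * l..<i * l + l}" for i
  have xs: "sorted_wrt (<) xs" "set xs = X" "length xs = card X"
    using assms(1) by (auto simp: xs_def)
  have bound: "i * l + l \<le> length xs" if "i < m" for i
  proof -
    have "i * l + l = Suc i * l" by simp
    also have "\<dots> \<le> m * l" using that by (intro mult_le_mono1) simp
    finally show ?thesis using assms(2) xs(3) by simp
  qed
  have sub: "Z i \<subseteq> X" if "i < m" for i
    using bound[OF that] xs(2) nth_mem by (fastforce simp: Z_def)
  have "inj_on ((!) xs) {i * l..<i * l + l}" if "i < m" for i
    using bound[OF that] by (intro inj_on_nth) (auto simp: xs_def)
  then have card: "card (Z i) = l" if "i < m" for i
    using that by (simp add: Z_def card_image)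
  have ord: "Z i \<lless> Z j" if "i < j" "j < m" for i j
    unfolding before_def
  proof (intro ballI)
    fix a b assume "a \<in> Z i" "b \<in> Z j"
    then obtain r s where r: "a = xs ! r" "r < i * l + l" and s: "b = xs ! s" "j * l \<le> s" "s < j * l + l"
      by (auto simp: Z_def)
    have "i * l + l = Suc i * l" by simp
    also have "\<dots> \<le> j * l" using that by (intro mult_le_mono1) simp
    finally have "r < s" using r(2) s(2) by simp
    moreover have "s < length xs" using s(3) bound[OF that(2)] by simp
    ultimately show "a < b"
      unfolding r(1) s(1) by (rule sorted_wrt_nth_less[OF xs(1)])
  qed
  show thesis by (rule that[of Z]) (use sub card ord in auto)
qed

section \<open>Densities of subsets and the choice of a transversal\<close>

lemma dens_subset:
  fixes \<eta> :: real
  assumes "\<And>x y. 0 \<le> \<beta> x y" "finite C" "D \<subseteq> C" "0 < \<eta>" "\<eta> * card C \<le> card D"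
  shows "\<eta> * dens \<beta> A D \<le> dens \<beta> A C"
proof -
  have "(\<Sum>x\<in>A. \<eta> * avdeg \<beta> x D) \<le> (\<Sum>x\<in>A. avdeg \<beta> x C)"
    by (intro sum_mono avdeg_subset assms)
  then have "\<eta> * (\<Sum>x\<in>A. avdeg \<beta> x D) / card A \<le> (\<Sum>x\<in>A. avdeg \<beta> x C) / card A"
    by (intro divide_right_mono) (simp_all add: sum_distrib_left)
  then show ?thesis by (simp add: dens_def)
qed

lemma dens_subsets:
  fixes \<eta> :: real
  assumes "\<And>x y. 0 \<le> \<beta> x y" "\<And>x y. \<beta> x y = \<beta> y x" "0 < \<eta>"
    "finite A" "A' \<subseteq> A" "\<eta> * card A \<le> card A'"
    "finite B" "B' \<subseteq> B" "\<eta> * card B \<le> card B'"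
  shows "\<eta>\<^sup>2 * dens \<beta> A' B' \<le> dens \<beta> A B"
proof -
  have "\<eta> * dens \<beta> A' B' \<le> dens \<beta> A' B"
    using assms by (intro dens_subset)
  then have "\<eta> * (\<eta> * dens \<beta> A' B') \<le> \<eta> * dens \<beta> B A'"
    using assms(2,3) by (simp add: dens_commute[of \<beta> B A'])
  also have "\<dots> \<le> dens \<beta> B A"
    using assms by (intro dens_subset)
  also have "\<dots> = dens \<beta> A B"
    using assms(2) by (rule dens_commute)
  finally show ?thesis by (simp add: power2_eq_square mult.assoc)
qed

text \<open>The method of conditional expectations: the candidate sets are replaced by singletons one at a
  time without increasing the total density.\<close>

lemma transversal_total_weight_le:
  fixes \<beta> :: "'b \<Rightarrow> 'b \<Rightarrow> real" and Y :: "'a \<Rightarrow> 'b set"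
  assumes \<beta>: "\<And>x y. \<beta> x y = \<beta> y x"
    and V: "finite V" "\<And>u. u \<in> V \<Longrightarrow> finite (Y u) \<and> Y u \<noteq> {}"
    and h: "\<And>u. h u u = 0"
  shows "\<exists>f. (\<forall>u\<in>V. f u \<in> Y u) \<and>
    (\<Sum>a\<in>V. \<Sum>b\<in>V. h a b * \<beta> (f a) (f b)) \<le> (\<Sum>a\<in>V. \<Sum>b\<in>V. h a b * dens \<beta> (Y a) (Y b))"
proof -
  define pot where "pot Z = (\<Sum>a\<in>V. \<Sum>b\<in>V. h a b * dens \<beta> (Z a) (Z b))" for Z :: "'a \<Rightarrow> 'b set"
  \<comment> \<open>The average of the left side over y equals the right side, so not every y can
    exceed it.\<close>
  have step: "\<exists>y\<in>Z u. pot (Z(u := {y})) \<le> pot Z" if "finite (Z u)" "Z u \<noteq> {}" for Z u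
  proof (rule ccontr)
    assume "\<not> ?thesis"
    then have lt: "pot Z < pot (Z(u := {y}))" if "y \<in> Z u" for y
      using that by (simp add: not_le)
    have cp: "0 < card (Z u)" using that by (simp add: card_gt_0_iff)
    have one: "(\<Sum>y\<in>Z u. dens \<beta> {y} B) = card (Z u) * dens \<beta> (Z u) B" for B
      using cp by (simp add: dens_def)
    have one': "(\<Sum>y\<in>Z u. dens \<beta> B {y}) = card (Z u) * dens \<beta> B (Z u)" for B
      using one[of B] by (simp only: dens_commute[where \<beta> = \<beta> and A = B, OF \<beta>])
    \<comment> \<open>Averaging works because a term changes in at most one argument: for a = b = u,
      where both would change, \<open>h\<close> vanishes.\<close>
    have summand: "(\<Sum>y\<in>Z u. h a b * dens \<beta> ((Z(u := {y})) a) ((Z(u := {y})) b)) =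
        card (Z u) * (h a b * dens \<beta> (Z a) (Z b))" for a b
      using one one' h by (cases "a = u"; cases "b = u") (simp_all add: mult_ac flip: sum_distrib_left)
    have "(\<Sum>y\<in>Z u. pot (Z(u := {y}))) =
        (\<Sum>a\<in>V. \<Sum>b\<in>V. \<Sum>y\<in>Z u. h a b * dens \<beta> ((Z(u := {y})) a) ((Z(u := {y})) b))"
      unfolding pot_def by (subst sum.swap) (intro sum.cong refl sum.swap)
    also have "\<dots> = card (Z u) * pot Z"
      unfolding summand pot_def by (simp add: sum_distrib_left)
    also have "\<dots> = (\<Sum>y\<in>Z u. pot Z)" by simp
    also have "\<dots> < (\<Sum>y\<in>Z u. pot (Z(u := {y})))"
      using that lt by (intro sum_strict_mono) auto
    finally show False by simp
  qed
  have "\<exists>f. (\<forall>u\<in>S. f u \<in> Y u) \<and> pot (\<lambda>u. if u \<in> S then {f u} else Y u) \<le> pot Y"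
    if "finite S" "S \<subseteq> V" for S
    using that
  proof (induction S)
    case empty
    show ?case by simp
  next
    case (insert u S)
    then obtain f where f: "\<forall>u\<in>S. f u \<in> Y u"
      and le: "pot (\<lambda>u. if u \<in> S then {f u} else Y u) \<le> pot Y" by auto
    let ?Z = "\<lambda>u. if u \<in> S then {f u} else Y u"
    have "finite (?Z u)" "?Z u \<noteq> {}" using V(2)[of u] insert.prems by auto
    from step[of ?Z u, OF this] obtain y where y: "y \<in> ?Z u" "pot (?Z(u := {y})) \<le> pot ?Z" by blast
    have "?Z(u := {y}) = (\<lambda>w. if w \<in> insert u S then {(f(u := y)) w} else Y w)"
      by (auto simp: fun_eq_iff)
    then have "pot (\<lambda>w. if w \<in> insert u S then {(f(u := y)) w} else Y w) \<le> pot Y"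
      using y(2) le by simp
    moreover have "\<forall>w\<in>insert u S. (f(u := y)) w \<in> Y w"
      using f y(1) insert.hyps by auto
    ultimately show ?case by blast
  qed
  from this[OF V(1) subset_refl] obtain f where f: "\<forall>u\<in>V. f u \<in> Y u"
    and le: "pot (\<lambda>u. if u \<in> V then {f u} else Y u) \<le> pot Y" by blast
  have "pot (\<lambda>u. if u \<in> V then {f u} else Y u) = (\<Sum>a\<in>V. \<Sum>b\<in>V. h a b * \<beta> (f a) (f b))"
    unfolding pot_def by (intro sum.cong refl) (simp add: dens_def avdeg_def)
  then show ?thesis using f le unfolding pot_def by auto
qed

section \<open>Doubling the number of sparse parts\<close>

definition sparse_parts ::
  "('b \<Rightarrow> 'b \<Rightarrow> real) \<Rightarrow> nat \<Rightarrow> nat \<Rightarrow> real \<Rightarrow> 'b::linorder set \<Rightarrow> (nat \<Rightarrow> 'b set) \<Rightarrow> bool" where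
  "sparse_parts \<beta> l m r X P \<longleftrightarrow>
     (\<forall>i<2^l. P i \<subseteq> X \<and> m \<le> card (P i)) \<and>
     (\<forall>i j. i < j \<and> j < 2^l \<longrightarrow> P i \<lless> P j \<and> dens \<beta> (P i) (P j) \<le> r)"

lemma sparse_parts_join:
  assumes P: "sparse_parts \<beta> l m r A P" and Q: "sparse_parts \<beta> l m r D Q"
    and "A \<subseteq> X" "D \<subseteq> X" "A \<lless> D"
    and cross: "\<And>i j. i < 2^l \<Longrightarrow> j < 2^l \<Longrightarrow> dens \<beta> (P i) (Q j) \<le> r"
  shows "sparse_parts \<beta> (Suc l) m r X (\<lambda>i. if i < 2^l then P i else Q (i - 2^l))"
    (is "sparse_parts _ _ _ _ _ ?R")
proof -
  have "?R i \<subseteq> X \<and> m \<le> card (?R i)" if "i < 2 ^ Suc l" for i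
  proof (cases "i < 2^l")
    case True
    then have "P i \<subseteq> A \<and> m \<le> card (P i)" using P unfolding sparse_parts_def by blast
    then show ?thesis using True assms(3) by auto
  next
    case False
    then have "i - 2^l < 2^l" using that by simp
    then have "Q (i - 2^l) \<subseteq> D \<and> m \<le> card (Q (i - 2^l))" using Q unfolding sparse_parts_def by blast
    then show ?thesis using False assms(4) by auto
  qed
  moreover have "?R i \<lless> ?R j \<and> dens \<beta> (?R i) (?R j) \<le> r" if ij: "i < j" "j < 2 ^ Suc l" for i j
  proof -
    consider "j < 2^l" | "i < 2^l" "2^l \<le> j" | "2^l \<le> i" by linarith
    then show ?thesis
    proof cases
      case 1
      then have "P i \<lless> P j \<and> dens \<beta> (P i) (P j) \<le> r" using P ij unfolding sparse_parts_def by blast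
      then show ?thesis using 1 ij by simp
    next
      case 2
      then have j: "j - 2^l < 2^l" using ij by simp
      have "P i \<lless> Q (j - 2^l)"
      proof (rule before_mono[OF assms(5)])
        show "P i \<subseteq> A" "Q (j - 2^l) \<subseteq> D"
          using P Q 2(1) j unfolding sparse_parts_def by blast+
      qed
      then show ?thesis using 2 cross[OF 2(1) j] by simp
    next
      case 3
      then have "i - 2^l < j - 2^l" "j - 2^l < 2^l" using ij by auto
      then have "Q (i - 2^l) \<lless> Q (j - 2^l) \<and> dens \<beta> (Q (i - 2^l)) (Q (j - 2^l)) \<le> r"
        using Q unfolding sparse_parts_def by blast
      then show ?thesis using 3 ij by simp
    qed
  qed
  ultimately show ?thesis unfolding sparse_parts_def by blast
qed

lemma sparse_parts_mono:
  "sparse_parts \<beta> l m r X P \<Longrightarrow> r \<le> r' \<Longrightarrow> sparse_parts \<beta> l m r' X P"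
  unfolding sparse_parts_def by (meson order_trans)

text \<open>One sparse pair is found in X, and the construction recurses in both halves. The bound
  on average degrees holds for each vertex of \<open>A\<close>, so it survives the passage to
  arbitrary parts of \<open>A\<close>. For \<open>D\<close> such a bound must first be restored by
  deleting vertices, after the parts of \<open>A\<close> are known and before recursing.\<close>

lemma sparse_parts_exist:
  fixes \<beta> :: "'b::linorder \<Rightarrow> 'b \<Rightarrow> real"
  assumes \<beta>: "\<And>x y. 0 \<le> \<beta> x y" "\<And>x y. \<beta> x y = \<beta> y x" and n: "0 < n"
    and \<epsilon>: "0 < \<epsilon>"
    and pair: "\<And>k X. finite X \<Longrightarrow> X \<subseteq> S \<Longrightarrow> n ^ (c + k) \<le> card X \<Longrightarrow>
      \<exists>A D. A \<subseteq> X \<and> D \<subseteq> X \<and> (A \<lless> D \<or> D \<lless> A) \<and> n ^ k \<le> card A \<and> 2 * n ^ k \<le> card D \<and>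
        (\<forall>a\<in>A. avdeg \<beta> a D \<le> \<epsilon>)"
    and X: "finite X" "X \<subseteq> S" "n ^ (l * c + k) \<le> card X"
  shows "\<exists>P. sparse_parts \<beta> l (n ^ k) (2 ^ l * \<epsilon>) X P"
  using X
proof (induction l arbitrary: X)
  case 0
  then have "sparse_parts \<beta> 0 (n ^ k) (2 ^ 0 * \<epsilon>) X (\<lambda>_. X)"
    by (simp add: sparse_parts_def)
  then show ?case by blast
next
  case (Suc l)
  let ?m = "n ^ (l * c + k)"
  have "n ^ (c + (l * c + k)) \<le> card X" using Suc.prems(3) by (simp add: add.assoc)
  from pair[OF Suc.prems(1,2) this] obtain A D where AD: "A \<subseteq> X" "D \<subseteq> X" "A \<lless> D \<or> D \<lless> A"
    and cA: "?m \<le> card A" and cD: "2 * ?m \<le> card D" and deg: "\<And>a. a \<in> A \<Longrightarrow> avdeg \<beta> a D \<le> \<epsilon>"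
    by blast
  have fin: "finite A" "finite D" using AD Suc.prems(1) finite_subset by auto
  have "A \<subseteq> S" using AD(1) Suc.prems(2) by blast
  from Suc.IH[OF fin(1) this cA] obtain P where P: "sparse_parts \<beta> l (n ^ k) (2 ^ l * \<epsilon>) A P" by blast
  \<comment> \<open>The mean of \<open>w\<close> over \<open>D\<close> is at most 2 ^ l *
    \<epsilon>. With twice this as threshold \<open>r\<close>, half of \<open>D\<close> survives,
    which is why \<open>D\<close> was required to be twice as large.\<close>
  define w where "w y = (\<Sum>i<2^l. avdeg \<beta> y (P i))" for y
  define r where "r = 2 * (2 ^ l * \<epsilon>)"
  have r: "0 < r" using \<epsilon> by (simp add: r_def)
  have w0: "0 \<le> w y" for y unfolding w_def by (intro sum_nonneg avdeg_nonneg \<beta>)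
  have "0 < ?m" using n by simp
  then have cD0: "0 < card D" using cD by linarith
  have "(\<Sum>y\<in>D. w y) = (\<Sum>i<2^l. \<Sum>y\<in>D. avdeg \<beta> y (P i))"
    unfolding w_def by (rule sum.swap)
  also have "\<dots> = (\<Sum>i<2^l. card D * dens \<beta> D (P i))"
    using cD0 by (simp add: dens_def)
  also have "\<dots> \<le> (\<Sum>i<(2::nat)^l. card D * \<epsilon>)"
  proof (intro sum_mono mult_left_mono)
    fix i :: nat assume "i \<in> {..<2^l}"
    then have "P i \<subseteq> A" using P by (simp add: sparse_parts_def)
    then have "dens \<beta> (P i) D \<le> \<epsilon>" using deg \<epsilon> by (intro dens_le) auto
    then show "dens \<beta> D (P i) \<le> \<epsilon>" using dens_commute[of \<beta> D "P i"] \<beta>(2) by simp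
  qed simp
  also have "\<dots> = r * (card D / 2)" by (simp add: r_def)
  finally have heavy: "card {y \<in> D. r < w y} \<le> real (card D) / 2"
    using markov_card[of D w r "card D / 2"] fin(2) w0 r by simp
  define D' where "D' = {y \<in> D. w y \<le> r}"
  have D'D: "D' \<subseteq> D" by (auto simp: D'_def)
  have "D = D' \<union> {y \<in> D. r < w y}" by (auto simp: D'_def)
  then have "card D \<le> card D' + card {y \<in> D. r < w y}" by (metis card_Un_le)
  then have "real (card D) \<le> 2 * card D'" using heavy by linarith
  then have cD': "?m \<le> card D'" using cD by linarith
  have "finite D'" "D' \<subseteq> S" using D'D fin(2) AD(2) Suc.prems(2) finite_subset by blast+
  from Suc.IH[OF this cD'] obtain Q where Q: "sparse_parts \<beta> l (n ^ k) (2 ^ l * \<epsilon>) D' Q" by blast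
  have cross: "dens \<beta> (Q j) (P i) \<le> r" if ij: "i < 2^l" "j < 2^l" for i j
  proof (rule dens_le)
    fix y assume "y \<in> Q j"
    then have "w y \<le> r" using Q ij(2) by (auto simp: sparse_parts_def D'_def)
    moreover have "avdeg \<beta> y (P i) \<le> w y"
      unfolding w_def using ij(1) by (intro member_le_sum avdeg_nonneg \<beta>) auto
    ultimately show "avdeg \<beta> y (P i) \<le> r" by linarith
  qed (use r in simp)
  then have cross': "dens \<beta> (P i) (Q j) \<le> r" if "i < 2^l" "j < 2^l" for i j
    using that dens_commute[of \<beta> "P i" "Q j"] \<beta>(2) by simp
  have "2 ^ l * \<epsilon> \<le> r" using \<epsilon> by (simp add: r_def)
  note P' = sparse_parts_mono[OF P this] and Q' = sparse_parts_mono[OF Q this]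
  have D'X: "D' \<subseteq> X" using D'D AD(2) by blast
  \<comment> \<open>The pair may lie in either order; the two halves are joined accordingly.\<close>
  have "A \<lless> D' \<or> D' \<lless> A" using AD(3) D'D by (auto simp: before_def)
  then have "\<exists>P. sparse_parts \<beta> (Suc l) (n ^ k) r X P"
    using sparse_parts_join[OF P' Q' AD(1) D'X] sparse_parts_join[OF Q' P' D'X AD(1)] cross cross'
    by blast
  then show ?case by (simp add: r_def mult.assoc)
qed

section \<open>Treating the colours in turn\<close>

text \<open>\<open>level\<close> stands for the position of a vertex's interval in an interval
  colouring, \<open>c\<close> colours the pairs of the host and \<open>S\<close> holds the host
  vertices. The number of levels is bounded by a power of 2 because the parts arise by
  \<open>L\<close> doublings.\<close>

locale ordered_pattern =
  fixes V :: "'a::linorder set" and E :: "'a set set" and v :: "nat \<Rightarrow> 'a" and n d p L :: nat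
    and level :: "'a \<Rightarrow> nat" and c :: "'b::linorder set \<Rightarrow> nat" and S :: "'b set"
  assumes n: "3 \<le> n" and d: "2 \<le> d" and p: "2 \<le> p"
    and V: "finite V" "card V = n" "bij_betw v {1..n} V"
    and E: "{u, w} \<in> E \<Longrightarrow> u \<in> V \<and> w \<in> V \<and> u \<noteq> w"
    and back_degree: "j \<in> {1..n} \<Longrightarrow> card {i \<in> {1..<j}. {v i, v j} \<in> E} \<le> d"
    and back_codegree: "1 \<le> i \<Longrightarrow> i < j \<Longrightarrow> j \<le> n \<Longrightarrow> {v i, v j} \<in> E \<Longrightarrow>
      card {k \<in> {1..<i}. {v k, v i} \<in> E \<and> {v k, v j} \<in> E} \<le> p - 1"
    and level_mono: "u \<in> V \<Longrightarrow> w \<in> V \<Longrightarrow> u \<le> w \<Longrightarrow> level u \<le> level w"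
    and level_edge: "{u, w} \<in> E \<Longrightarrow> level u \<noteq> level w"
    and level_less: "u \<in> V \<Longrightarrow> level u < 2 ^ L"
    and L: "2 ^ L \<le> 2 * n"
begin

definition lower :: "nat \<Rightarrow> 'b \<Rightarrow> 'b \<Rightarrow> real" where
  "lower s x y = of_bool (c {x, y} < s)"

definition sparse_family :: "nat \<Rightarrow> nat \<Rightarrow> real \<Rightarrow> 'b set \<Rightarrow> ('a \<Rightarrow> 'b set) \<Rightarrow> bool" where
  "sparse_family s m \<rho> X Y \<longleftrightarrow>
     (\<forall>u\<in>V. Y u \<subseteq> X \<and> m \<le> card (Y u)) \<and> (\<forall>u\<in>V. \<forall>w\<in>V. u < w \<longrightarrow> Y u \<lless> Y w) \<and>
     (\<forall>u w. {u, w} \<in> E \<longrightarrow> dens (lower s) (Y u) (Y w) \<le> \<rho>)"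

text \<open>The cost \<kappa> is a loss in the exponent of n. Quantifying over all large subsets of
  \<open>S\<close> and all k lets the property be used again inside the sets that it
  produces.\<close>

definition has_families :: "nat \<Rightarrow> nat \<Rightarrow> real \<Rightarrow> bool" where
  "has_families s \<kappa> \<rho> \<longleftrightarrow> (\<forall>k X. finite X \<and> X \<subseteq> S \<and> n ^ (\<kappa> + k) \<le> card X \<longrightarrow>
     (\<exists>Y. sparse_family s (n ^ k) \<rho> X Y))"

definition monochromatic_copy :: "nat \<Rightarrow> ('a \<Rightarrow> 'b) \<Rightarrow> bool" where
  "monochromatic_copy s f \<longleftrightarrow>
     strict_mono_on V f \<and> f ` V \<subseteq> S \<and> (\<forall>u w. {u, w} \<in> E \<longrightarrow> c {f u, f w} = s)"

definition rank :: "'a \<Rightarrow> nat" where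
  "rank u = card {w \<in> V. w < u}"

lemma lower_nonneg: "0 \<le> lower s x y"
  by (simp add: lower_def)

lemma lower_commute: "lower s x y = lower s y x"
  by (simp add: lower_def insert_commute)

lemma lower_Suc: "lower (Suc s) x y = lower s x y + of_bool (c {x, y} = s)"
  by (simp add: lower_def of_bool_def)

lemma rank_less: "u \<in> V \<Longrightarrow> rank u < n"
  unfolding rank_def V(2)[symmetric] using V(1) by (intro psubset_card_mono) auto

lemma rank_mono: "u \<in> V \<Longrightarrow> u < w \<Longrightarrow> rank u < rank w"
  unfolding rank_def using V(1) by (intro psubset_card_mono) auto

text \<open>No colour lies below 0, so all densities vanish and only the order has to be arranged;
  cutting X into n blocks costs one power of n.\<close>

lemma has_families_0:
  assumes "0 \<le> \<rho>"
  shows "has_families 0 1 \<rho>"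
  unfolding has_families_def
proof (intro allI impI)
  fix k and X :: "'b set" assume X: "finite X \<and> X \<subseteq> S \<and> n ^ (1 + k) \<le> card X"
  then have "finite X" "n * n ^ k \<le> card X" by auto
  from chop[OF this] obtain Z where Z: "\<And>i. i < n \<Longrightarrow> Z i \<subseteq> X" "\<And>i. i < n \<Longrightarrow> card (Z i) = n ^ k"
    "\<And>i j. i < j \<Longrightarrow> j < n \<Longrightarrow> Z i \<lless> Z j" by blast
  have "dens (lower 0) A B = 0" for A B
    by (simp add: dens_def avdeg_def lower_def)
  then have "sparse_family 0 (n ^ k) \<rho> X (\<lambda>u. Z (rank u))"
    using Z rank_less rank_mono assms by (simp add: sparse_family_def)
  then show "\<exists>Y. sparse_family 0 (n ^ k) \<rho> X Y" by blast
qed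

text \<open>The greedy embedding is run in colour s on a family sparse in the colours below s.
  Without a copy it yields a pair sparse in all colours up to s.\<close>

lemma sparse_pair_in_set:
  fixes e :: nat and \<rho> :: real
  defines "\<epsilon> \<equiv> 1 / real n ^ e"
  assumes fam: "has_families s \<kappa> \<rho>" and \<rho>: "0 \<le> \<rho>" "6 * n ^ 3 * \<rho> \<le> \<epsilon> * (\<epsilon> / n) ^ (p - 1)"
    and no_copy: "\<And>f. \<not> monochromatic_copy s f"
    and X: "finite X" "X \<subseteq> S" "n ^ (\<kappa> + d * (e + 2) + k) \<le> card X"
  shows "\<exists>A D. A \<subseteq> X \<and> D \<subseteq> X \<and> (A \<lless> D \<or> D \<lless> A) \<and> n ^ k \<le> card A \<and> 2 * n ^ k \<le> card D \<and>
        (\<forall>a\<in>A. avdeg (lower (Suc s)) a D \<le> 2 * \<epsilon>)"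
proof -
  let ?m = "n ^ (d * (e + 2) + k)"
  have "n ^ (\<kappa> + (d * (e + 2) + k)) \<le> card X" using X(3) by (simp add: add.assoc)
  then obtain Y where Y: "sparse_family s ?m \<rho> X Y"
    using fam X(1,2) unfolding has_families_def by blast
  have YX: "Y u \<subseteq> X" "?m \<le> card (Y u)" if "u \<in> V" for u
    using Y that unfolding sparse_family_def by blast+
  have Yord: "Y u \<lless> Y w" if "u \<in> V" "w \<in> V" "u < w" for u w
    using Y that unfolding sparse_family_def by blast
  have Ydens: "dens (lower s) (Y u) (Y w) \<le> \<rho>" if "{u, w} \<in> E" for u w
    using Y that unfolding sparse_family_def by blast
  have vV: "v i \<in> V" if "i \<in> {1..n}" for i
    using V(3) that by (auto simp: bij_betw_def)
  have n0: "0 < n" using n by simp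
  then have m0: "0 < ?m" by simp
  interpret greedy_embedding n d p "\<lambda>i j. {v i, v j} \<in> E" "\<lambda>i. Y (v i)" "\<lambda>x y. c {x, y} = s"
    "lower s" \<epsilon> \<rho>
  proof (unfold_locales, goal_cases)
    case 1
    show ?case using n by simp
  next
    case (2 i j)
    show ?case by (simp add: insert_commute)
  next
    case (3 i)
    show ?case using E[of "v i" "v i"] by blast
  next
    case (4 j)
    then show ?case by (rule back_degree)
  next
    case (5 i j)
    then show ?case by (rule back_codegree)
  next
    case (6 i)
    then show ?case using YX(1)[OF vV] X(1) finite_subset by blast
  next
    case (7 i)
    then show ?case using YX(2)[OF vV, of i] m0 by auto
  next
    case 8
    show ?case by (rule lower_nonneg)
  next
    case (9 x y)
    show ?case by (rule lower_commute)
  next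
    case 10
    show ?case using n0 by (simp add: \<epsilon>_def)
  next
    case 11
    show ?case using n0 by (simp add: \<epsilon>_def)
  next
    case 12
    then show ?case using Ydens by simp
  next
    case 13
    show ?case by (rule \<rho>(1))
  next
    case 14
    show ?case using \<rho>(2) by simp
  qed
  have G_commute: "(c {x, y} = s) = (c {y, x} = s)" for x y
    by (simp add: insert_commute)
  show ?thesis
  proof (rule embedding_or_sparse_pair[OF G_commute])
    fix x assume x: "\<And>i. i \<in> {1..n} \<Longrightarrow> x i \<in> Y (v i)"
      "\<And>i j. i \<in> {1..n} \<Longrightarrow> j \<in> {1..n} \<Longrightarrow> {v i, v j} \<in> E \<Longrightarrow> c {x i, x j} = s"
    define g where "g = inv_into {1..n} v"
    have g: "g u \<in> {1..n}" "v (g u) = u" if "u \<in> V" for u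
      using V(3) that unfolding g_def bij_betw_def by (metis inv_into_into, metis f_inv_into_f)
    have xg: "x (g u) \<in> Y u" if "u \<in> V" for u
      using x(1)[OF g(1)[OF that]] g(2)[OF that] by simp
    have "strict_mono_on V (\<lambda>u. x (g u))"
      using Yord xg unfolding before_def strict_mono_on_def by blast
    moreover have "(\<lambda>u. x (g u)) ` V \<subseteq> S"
      using xg YX(1) X(2) by blast
    moreover have "c {x (g u), x (g w)} = s" if "{u, w} \<in> E" for u w
      using x(2)[of "g u" "g w"] g[of u] g[of w] E[OF that] that by simp
    ultimately have "monochromatic_copy s (\<lambda>u. x (g u))"
      unfolding monochromatic_copy_def by blast
    then show ?thesis using no_copy by blast
  next
    fix i j A D assume ij: "i \<in> {1..n}" "j \<in> {1..n}" "i \<noteq> j" and AD: "sparse_pair i j A D"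
    have sub: "A \<subseteq> Y (v i)" "D \<subseteq> Y (v j)" using AD by (auto simp: sparse_pair_def)
    \<comment> \<open>Since \<epsilon> / n is n to the power -(e + 1), d powers of n are left beyond
      n ^ k. They absorb the factor 2 * n for \<open>A\<close> and the 2 wanted for
      \<open>D\<close>, as 2 * n \<le> n ^ 2 \<le> n ^ d.\<close>
    have \<eta>m: "(\<epsilon> / n) ^ d * ?m = real n ^ (d + k)"
    proof -
      have "\<epsilon> / n = 1 / real n ^ (e + 1)" by (simp add: \<epsilon>_def)
      then have "(\<epsilon> / n) ^ d = 1 / real n ^ (d * (e + 1))"
        by (simp only: power_one_over mult.commute[of d] power_mult)
      moreover have "real ?m = real n ^ (d * (e + 1) + (d + k))"
        by (simp add: algebra_simps)
      ultimately show ?thesis using n0 unfolding power_add by simp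
    qed
    have nonneg: "0 \<le> (\<epsilon> / n) ^ d" by (simp add: \<epsilon>_def)
    then have le: "real n ^ (d + k) \<le> (\<epsilon> / n) ^ d * card (Y (v i))" if "i \<in> {1..n}" for i
    proof -
      have "real ?m \<le> card (Y (v i))" using YX(2)[OF vV[OF that]] by (simp only: of_nat_le_iff)
      then show ?thesis unfolding \<eta>m[symmetric] using nonneg by (rule mult_left_mono)
    qed
    have "n ^ 2 \<le> n ^ d" using n0 d by (intro power_increasing) auto
    moreover have "2 * n \<le> n ^ 2" using n by (simp add: power2_eq_square)
    ultimately have nd: "2 * n \<le> n ^ d" "2 \<le> n ^ d" using n by linarith+
    have "real n ^ (d + k) \<le> real (2 * n * card A)"
      using le[OF ij(1)] AD unfolding sparse_pair_def by simp
    then have "n ^ (d + k) \<le> 2 * n * card A"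
      by (simp only: of_nat_le_iff flip: of_nat_power)
    then have "2 * n * n ^ k \<le> 2 * n * card A"
      using mult_le_mono1[OF nd(1), of "n ^ k"] unfolding power_add by (rule order_trans[rotated])
    then have cA: "n ^ k \<le> card A" using n0 by simp
    have "real n ^ (d + k) \<le> card D"
      using le[OF ij(2)] AD unfolding sparse_pair_def by linarith
    then have "n ^ (d + k) \<le> card D"
      by (simp only: of_nat_le_iff flip: of_nat_power)
    then have cD: "2 * n ^ k \<le> card D"
      using mult_le_mono1[OF nd(2), of "n ^ k"] unfolding power_add by (rule order_trans[rotated])
    have deg: "avdeg (lower (Suc s)) a D \<le> 2 * \<epsilon>" if "a \<in> A" for a
      using AD that by (simp add: sparse_pair_def lower_Suc[abs_def])
    have "v i \<noteq> v j"
      using V(3) ij unfolding bij_betw_def inj_on_def by blast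
    then have "Y (v i) \<lless> Y (v j) \<or> Y (v j) \<lless> Y (v i)"
      using Yord vV[OF ij(1)] vV[OF ij(2)] by (meson linorder_neqE)
    then have "A \<lless> D \<or> D \<lless> A" using sub unfolding before_def by blast
    moreover have "A \<subseteq> X" "D \<subseteq> X"
      using order_trans[OF sub(1) YX(1)] order_trans[OF sub(2) YX(1)] vV ij by auto
    moreover have "\<forall>a\<in>A. avdeg (lower (Suc s)) a D \<le> 2 * \<epsilon>"
      using deg by (rule ballI)
    ultimately show ?thesis
      using cA cD by (intro exI[of _ A] exI[of _ D] conjI)
  qed
qed

text \<open>Each of the \<open>L\<close> doublings costs one family and one embedding attempt; the
  final 1 in the exponent pays for cutting every part into n pieces.\<close>

lemma has_families_Suc:
  fixes e :: nat and \<rho> :: real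
  assumes fam: "has_families s \<kappa> \<rho>"
    and \<rho>: "0 \<le> \<rho>" "6 * n ^ 3 * \<rho> \<le> 1 / real n ^ e * (1 / real n ^ e / n) ^ (p - 1)"
    and no_copy: "\<And>f. \<not> monochromatic_copy s f"
  shows "has_families (Suc s) (L * (\<kappa> + d * (e + 2)) + 1) (n ^ 6 / n ^ e)"
  unfolding has_families_def
proof (intro allI impI)
  fix k and X :: "'b set"
  let ?c = "\<kappa> + d * (e + 2)" and ?\<epsilon> = "1 / real n ^ e"
  assume "finite X \<and> X \<subseteq> S \<and> n ^ (L * ?c + 1 + k) \<le> card X"
  then have X: "finite X" "X \<subseteq> S" "n ^ (L * ?c + (k + 1)) \<le> card X" by (simp_all add: ac_simps)
  have n0: "0 < n" using n by simp
  have \<epsilon>0: "0 < 2 * ?\<epsilon>" using n0 by simp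
  have "\<exists>P. sparse_parts (lower (Suc s)) L (n ^ (k + 1)) (2 ^ L * (2 * ?\<epsilon>)) X P"
    by (rule sparse_parts_exist[OF lower_nonneg lower_commute n0 \<epsilon>0 _ X],
        rule sparse_pair_in_set[OF fam \<rho> no_copy])
  then obtain P where P: "sparse_parts (lower (Suc s)) L (n ^ (k + 1)) (2 ^ L * (2 * ?\<epsilon>)) X P"
    by blast
  have PX: "P i \<subseteq> X" "n ^ (k + 1) \<le> card (P i)" if "i < 2 ^ L" for i
    using P that unfolding sparse_parts_def by blast+
  have PP: "P i \<lless> P j" "dens (lower (Suc s)) (P i) (P j) \<le> 2 ^ L * (2 * ?\<epsilon>)"
    if "i < j" "j < 2 ^ L" for i j
    using P that unfolding sparse_parts_def by blast+
  have fin: "finite (P i)" if "i < 2 ^ L" for i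
    using PX(1)[OF that] X(1) by (rule finite_subset)
  have "\<exists>Z. (\<forall>r<n. Z r \<subseteq> P i \<and> card (Z r) = card (P i) div n) \<and> (\<forall>r t. r < t \<and> t < n \<longrightarrow> Z r \<lless> Z t)"
    if "i < 2 ^ L" for i
  proof -
    have "n * (card (P i) div n) \<le> card (P i)" by simp
    from chop[OF fin[OF that] this] obtain Z where "\<And>r. r < n \<Longrightarrow> Z r \<subseteq> P i"
      "\<And>r. r < n \<Longrightarrow> card (Z r) = card (P i) div n" "\<And>r t. r < t \<Longrightarrow> t < n \<Longrightarrow> Z r \<lless> Z t"
      by blast
    then show ?thesis by blast
  qed
  then obtain Z where Z: "\<And>i. i < 2 ^ L \<Longrightarrow> (\<forall>r<n. Z i r \<subseteq> P i \<and> card (Z i r) = card (P i) div n) \<and>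
      (\<forall>r t. r < t \<and> t < n \<longrightarrow> Z i r \<lless> Z i t)"
    by metis
  \<comment> \<open>Vertices of one level are nonadjacent, so they may share a part; the rank puts
    them into distinct pieces in the right order.\<close>
  define Y where "Y u = Z (level u) (rank u)" for u
  have YP: "Y u \<subseteq> P (level u)" "card (Y u) = card (P (level u)) div n" if "u \<in> V" for u
    using Z[OF level_less[OF that]] rank_less[OF that] by (auto simp: Y_def)
  have cY: "n ^ k \<le> card (Y u)" if "u \<in> V" for u
  proof -
    have "n ^ k * n \<le> card (P (level u))" using PX(2)[OF level_less[OF that]] by (simp add: mult.commute)
    then show ?thesis using n0 YP(2)[OF that] by (simp add: less_eq_div_iff_mult_less_eq)
  qed
  \<comment> \<open>Rounding down costs at most a factor 2 because the quotient is at least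
    1.\<close>
  have share: "1 / real (2 * n) * card (P (level u)) \<le> card (Y u)" if "u \<in> V" for u
  proof -
    let ?x = "card (P (level u))"
    have "1 \<le> ?x div n" using cY[OF that] YP(2)[OF that] n0 by (metis One_nat_def Suc_leI le_trans zero_less_power)
    then have "n \<le> n * (?x div n)" by simp
    moreover have "?x < n * (?x div n) + n"
      using n0 by (metis add.commute add_strict_left_mono mod_less_divisor mult_div_mod_eq)
    ultimately have "?x \<le> 2 * n * (?x div n)" by linarith
    then have "real ?x \<le> 2 * n * card (Y u)"
      unfolding YP(2)[OF that] by (simp only: of_nat_le_iff)
    then show ?thesis using n0 by (simp add: field_simps)
  qed
  have less: "Y u \<lless> Y w" if uw: "u \<in> V" "w \<in> V" "u < w" for u w
  proof (cases "level u = level w")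
    case True
    then show ?thesis
      using Z[OF level_less[OF uw(2)]] rank_mono[OF uw(1,3)] rank_less[OF uw(2)] by (simp add: Y_def)
  next
    case False
    then have "level u < level w" using level_mono[OF uw(1,2) less_imp_le[OF uw(3)]] by simp
    then show ?thesis
      using before_mono[OF PP(1)[OF _ level_less[OF uw(2)]] YP(1)[OF uw(1)] YP(1)[OF uw(2)]] by simp
  qed
  have dens: "dens (lower (Suc s)) (Y u) (Y w) \<le> n ^ 6 / n ^ e" if uw: "{u, w} \<in> E" for u w
  proof -
    note in_V = E[OF uw]
    have Puw: "dens (lower (Suc s)) (P (level u)) (P (level w)) \<le> 2 ^ L * (2 * ?\<epsilon>)"
    proof (cases "level u < level w")
      case True
      then show ?thesis using PP(2) level_less in_V by simp
    next
      case False
      then have "level w < level u" using level_edge[OF uw] by simp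
      then show ?thesis
        using PP(2)[of "level w" "level u"] level_less[of u] in_V
          dens_commute[of "lower (Suc s)" "P (level u)" "P (level w)", OF lower_commute] by simp
    qed
    \<comment> \<open>Restricting both sets costs (2 * n) ^ 2 and the parts have density at most 4 *
      n * \<epsilon>, in total 16 * n ^ 3 * \<epsilon>; finally 16 \<le> 27 \<le> n ^ 3.\<close>
    have "(1 / real (2 * n))\<^sup>2 * dens (lower (Suc s)) (Y u) (Y w)
        \<le> dens (lower (Suc s)) (P (level u)) (P (level w))"
      using in_V n0 fin level_less YP(1) share
      by (intro dens_subsets lower_nonneg lower_commute) auto
    also have "\<dots> \<le> 2 ^ L * (2 * ?\<epsilon>)" by (rule Puw)
    also have "\<dots> \<le> (2 * n) * (2 * ?\<epsilon>)"
    proof (rule mult_right_mono)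
      show "(2::real) ^ L \<le> real (2 * n)"
        using L by (metis of_nat_le_iff of_nat_numeral of_nat_power)
    qed (use \<epsilon>0 in simp)
    finally have "dens (lower (Suc s)) (Y u) (Y w) \<le> 16 * n ^ 3 * ?\<epsilon>"
      using n0 by (simp add: field_simps power2_eq_square power3_eq_cube)
    also have "\<dots> \<le> n ^ 6 * ?\<epsilon>"
    proof (rule mult_right_mono)
      have "(3::nat) ^ 3 \<le> n ^ 3" using n by (intro power_mono) auto
      then have "16 * n ^ 3 \<le> n ^ 3 * n ^ 3" by (intro mult_right_mono) auto
      also have "n ^ 3 * n ^ 3 = n ^ 6" by (simp flip: power_add)
      finally show "16 * n ^ 3 \<le> real (n ^ 6)"
        by (metis of_nat_le_iff of_nat_mult of_nat_numeral of_nat_power)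
    qed simp
    finally show ?thesis by simp
  qed
  have "Y u \<subseteq> X" if "u \<in> V" for u
    using YP(1)[OF that] PX(1)[OF level_less[OF that]] by blast
  then have "sparse_family (Suc s) (n ^ k) (n ^ 6 / n ^ e) X Y"
    unfolding sparse_family_def using cY less dens by blast
  then show "\<exists>Y. sparse_family (Suc s) (n ^ k) (n ^ 6 / n ^ e) X Y" by blast
qed

text \<open>The densities over all ordered pairs sum to at most n ^ 2 / n ^ 3 < 1. A transversal of
  total weight below 1 has weight 0, since each term is 0 or 1, so no pattern edge gets a colour
  below s.\<close>

lemma monochromatic_copy_of_last_colour:
  assumes fam: "has_families s \<kappa> (1 / real n ^ 3)" and S: "finite S" "n ^ \<kappa> \<le> card S"
    and last: "\<And>x y. x \<in> S \<Longrightarrow> y \<in> S \<Longrightarrow> x < y \<Longrightarrow> c {x, y} \<le> s"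
  shows "\<exists>f. monochromatic_copy s f"
proof -
  have "n ^ (\<kappa> + 0) \<le> card S" using S by simp
  then obtain Y where Y: "sparse_family s (n ^ 0) (1 / real n ^ 3) S Y"
    using fam S(1) unfolding has_families_def by blast
  have YS: "Y u \<subseteq> S" "1 \<le> card (Y u)" if "u \<in> V" for u
    using Y that unfolding sparse_family_def by auto
  have Yord: "Y u \<lless> Y w" if "u \<in> V" "w \<in> V" "u < w" for u w
    using Y that unfolding sparse_family_def by blast
  have Ydens: "dens (lower s) (Y u) (Y w) \<le> 1 / real n ^ 3" if "{u, w} \<in> E" for u w
    using Y that unfolding sparse_family_def by blast
  define h :: "'a \<Rightarrow> 'a \<Rightarrow> real" where "h u w = of_bool ({u, w} \<in> E)" for u w
  have "h u u = 0" for u using E[of u u] by (auto simp: h_def)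
  moreover have "finite (Y u) \<and> Y u \<noteq> {}" if "u \<in> V" for u
    using YS[OF that] S(1) finite_subset by fastforce
  ultimately obtain f where f: "\<And>u. u \<in> V \<Longrightarrow> f u \<in> Y u"
    and le: "(\<Sum>a\<in>V. \<Sum>b\<in>V. h a b * lower s (f a) (f b))
      \<le> (\<Sum>a\<in>V. \<Sum>b\<in>V. h a b * dens (lower s) (Y a) (Y b))"
    using transversal_total_weight_le[of "lower s" V Y h, OF lower_commute V(1)] by blast
  have "(\<Sum>a\<in>V. \<Sum>b\<in>V. h a b * dens (lower s) (Y a) (Y b)) \<le> (\<Sum>a\<in>V. \<Sum>b\<in>V. 1 / real n ^ 3)"
    using Ydens by (intro sum_mono) (simp add: h_def of_bool_def)
  also have "\<dots> = 1 / n"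
    using n by (simp add: V(2) power3_eq_cube)
  also have "\<dots> < 1" using n by simp
  finally have lt1: "(\<Sum>a\<in>V. \<Sum>b\<in>V. h a b * lower s (f a) (f b)) < 1"
    using le by linarith
  have ord: "f u < f w" if "u \<in> V" "w \<in> V" "u < w" for u w
    using Yord[OF that] f that unfolding before_def by blast
  have lower: "s \<le> c {f u, f w}" if uw: "{u, w} \<in> E" for u w
  proof (rule ccontr)
    assume "\<not> ?thesis"
    then have "1 = h u w * lower s (f u) (f w)" using uw by (simp add: h_def lower_def)
    also have "\<dots> \<le> (\<Sum>b\<in>V. h u b * lower s (f u) (f b))"
      using E[OF uw] V(1) lower_nonneg
      by (intro member_le_sum[of w V "\<lambda>b. h u b * lower s (f u) (f b)"]) (auto simp: h_def)
    also have "\<dots> \<le> (\<Sum>a\<in>V. \<Sum>b\<in>V. h a b * lower s (f a) (f b))"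
      using E[OF uw] V(1) lower_nonneg
      by (intro member_le_sum[of u V "\<lambda>a. \<Sum>b\<in>V. h a b * lower s (f a) (f b)"] sum_nonneg)
        (auto simp: h_def)
    finally show False using lt1 by simp
  qed
  have fS: "f u \<in> S" if "u \<in> V" for u using f[OF that] YS(1)[OF that] by blast
  have "c {f u, f w} = s" if uw: "{u, w} \<in> E" for u w
  proof -
    have "f u < f w \<or> f w < f u"
      using E[OF uw] ord by (meson linorder_neqE)
    then have "c {f u, f w} \<le> s"
      using last[of "f u" "f w"] last[of "f w" "f u"] fS E[OF uw] by (auto simp: insert_commute)
    then show ?thesis using lower[OF uw] by simp
  qed
  moreover have "strict_mono_on V f" using ord by (simp add: strict_mono_on_def)
  ultimately show ?thesis
    using fS unfolding monochromatic_copy_def by blast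
qed

end

section \<open>The exponents\<close>

text \<open>While treating colour \<open>q - 2 - j\<close> we take \<open>\<epsilon> = 1 / n ^ dexp p j\<close>. The recursion makes room for
  the factor \<open>\<epsilon> (\<epsilon> / n) ^ (p - 1)\<close> demanded by the embedding and for the polynomial losses, which fit into
  \<open>n ^ 11\<close>. A set of \<open>n ^ cost d p L (q - 2) s\<close> vertices suffices to make \<open>s\<close> colours sparse.\<close>

primrec dexp :: "nat \<Rightarrow> nat \<Rightarrow> nat" where
  "dexp p 0 = 9"
| "dexp p (Suc j) = p * dexp p j + p + 10"

primrec cost :: "nat \<Rightarrow> nat \<Rightarrow> nat \<Rightarrow> nat \<Rightarrow> nat \<Rightarrow> nat" where
  "cost d p L Q 0 = 1"
| "cost d p L Q (Suc s) = L * (cost d p L Q s + d * (dexp p (Q - s) + 2)) + 1"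

text \<open>Adding 12 makes the induction close: p + 22 \<le> 12 * p holds from p = 2 on.\<close>

lemma dexp_le:
  assumes "2 \<le> p"
  shows "dexp p j + 12 \<le> 21 * p ^ j"
proof (induction j)
  case (Suc j)
  have "p * (dexp p j + 12) \<le> p * (21 * p ^ j)"
    using Suc by (intro mult_left_mono) auto
  then have "p * dexp p j + 12 * p \<le> 21 * p ^ Suc j"
    by (simp add: algebra_simps)
  then show ?case using assms by simp
qed simp

text \<open>The second summand is slack for the induction. Multiplied by L, it is p \<ge> 2 times
  the slack needed next; one copy pays for the next colour and one is kept. This is the summation of
  a geometric series.\<close>

lemma cost_le:
  assumes d: "2 \<le> d" and p: "2 \<le> p" and L: "1 \<le> L" and "s \<le> Q"
  shows "cost d p L Q (Suc s) + 21 * d * L ^ Suc s * p ^ (Q - s) \<le> 42 * d * p ^ Q * L ^ Suc s"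
  using \<open>s \<le> Q\<close>
proof (induction s)
  case 0
  have "d * (dexp p Q + 12) \<le> d * (21 * p ^ Q)"
    using dexp_le[OF p, of Q] by (intro mult_left_mono) auto
  then have "d * (dexp p Q + 2) + 10 * d \<le> 21 * d * p ^ Q" by (simp add: algebra_simps)
  then have "1 + d * (dexp p Q + 2) + 1 \<le> 21 * d * p ^ Q" using d by linarith
  then have "L * (1 + d * (dexp p Q + 2) + 1) \<le> L * (21 * d * p ^ Q)"
    by (rule mult_le_mono2)
  moreover have "L * (1 + d * (dexp p Q + 2) + 1) = L * (1 + d * (dexp p Q + 2)) + L"
    by (simp add: algebra_simps)
  moreover have "L * (21 * d * p ^ Q) = 21 * (d * L * p ^ Q)" by simp
  moreover have 1: "21 * d * L ^ Suc 0 * p ^ (Q - 0) = 21 * (d * L * p ^ Q)"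
    "42 * d * p ^ Q * L ^ Suc 0 = 42 * (d * L * p ^ Q)" by simp_all
  moreover have 2: "cost d p L Q (Suc 0) = L * (1 + d * (dexp p Q + 2)) + 1" by simp
  ultimately show ?case unfolding 1 2 using L by linarith
next
  case (Suc s)
  define x where "x = d * L ^ Suc (Suc s)"
  define y where "y = p ^ (Q - Suc s)"
  have Qs: "Q - s = Suc (Q - Suc s)" using Suc.prems by simp
  have IH: "cost d p L Q (Suc s) + 21 * d * L ^ Suc s * p ^ (Q - s) \<le> 42 * d * p ^ Q * L ^ Suc s"
    using Suc by simp
  have "L * cost d p L Q (Suc s) + L * (21 * d * L ^ Suc s * p ^ (Q - s)) \<le> L * (42 * d * p ^ Q * L ^ Suc s)"
    using mult_le_mono2[OF IH, of L] by (simp only: add_mult_distrib2)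
  moreover have "L * (21 * d * L ^ Suc s * p ^ (Q - s)) = 21 * (x * (p * y))"
    unfolding Qs x_def y_def by simp
  moreover have "L * (42 * d * p ^ Q * L ^ Suc s) = 42 * d * p ^ Q * L ^ Suc (Suc s)"
    by simp
  moreover have "x * (2 * y) \<le> x * (p * y)"
    using p by (intro mult_le_mono) auto
  ultimately have 1: "L * cost d p L Q (Suc s) + 42 * (x * y) \<le> 42 * d * p ^ Q * L ^ Suc (Suc s)"
    by linarith
  have "d * (dexp p (Q - Suc s) + 12) \<le> d * (21 * y)"
    using dexp_le[OF p, of "Q - Suc s"] unfolding y_def by (rule mult_le_mono2)
  then have "d * (dexp p (Q - Suc s) + 2) + 1 \<le> d * (21 * y)" using d by (simp add: algebra_simps)
  then have "L * (d * (dexp p (Q - Suc s) + 2) + 1) \<le> L * (d * (21 * y))"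
    by (rule mult_le_mono2)
  also have "\<dots> \<le> L ^ Suc (Suc s) * (d * (21 * y))"
    using L by (intro mult_le_mono1) simp
  also have "\<dots> = 21 * (x * y)" by (simp add: x_def)
  finally have 2: "L * (d * (dexp p (Q - Suc s) + 2)) + L \<le> 21 * (x * y)"
    by (simp add: algebra_simps)
  have 3: "21 * d * L ^ Suc (Suc s) * p ^ (Q - Suc s) = 21 * (x * y)"
    by (simp add: x_def y_def)
  have 4: "cost d p L Q (Suc (Suc s)) = L * cost d p L Q (Suc s) + L * (d * (dexp p (Q - Suc s) + 2)) + 1"
    by (simp add: algebra_simps)
  show ?case unfolding 3 4 using 1 2 L by linarith
qed

text \<open>With e = \<open>dexp p j\<close>, the recursion gives the exponent e + (e + 1) * (p - 1)
  + 11. The first two terms account for the right side, and n ^ 11 beats 6 * n ^ 9.\<close>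

lemma dexp_step:
  fixes n :: nat
  assumes "3 \<le> n" "2 \<le> p"
  shows "6 * n ^ 3 * (n ^ 6 / real n ^ dexp p (Suc j)) \<le>
    1 / real n ^ dexp p j * (1 / real n ^ dexp p j / n) ^ (p - 1)"
proof -
  let ?e = "dexp p j" and ?x = "real n"
  have x: "3 \<le> ?x" using assms(1) by simp
  define M where "M = ?x ^ (?e + Suc ?e * (p - 1))"
  have M: "0 < M" using x by (simp add: M_def)
  obtain r where r: "p = Suc r" using assms(2) by (cases p) auto
  have "dexp p (Suc j) = (?e + Suc ?e * (p - 1)) + 11"
    unfolding r by simp
  then have "?x ^ dexp p (Suc j) = M * ?x ^ 11"
    unfolding M_def by (simp only: power_add)
  then have "6 * n ^ 3 * (n ^ 6 / real n ^ dexp p (Suc j)) = 6 / ?x\<^sup>2 / M"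
    using x M by (simp add: field_simps flip: power_add)
  also have "\<dots> \<le> 1 / M"
  proof (rule divide_right_mono)
    have "3\<^sup>2 \<le> ?x\<^sup>2" using x by (intro power_mono) auto
    then show "6 / ?x\<^sup>2 \<le> 1" using x by (simp add: divide_le_eq)
  qed (use M in simp)
  also have "1 / M = 1 / ?x ^ ?e * (1 / ?x ^ ?e / ?x) ^ (p - 1)"
  proof -
    have "1 / ?x ^ ?e / ?x = 1 / ?x ^ Suc ?e" by simp
    then have "(1 / ?x ^ ?e / ?x) ^ (p - 1) = 1 / ?x ^ (Suc ?e * (p - 1))"
      by (simp only: power_one_over power_mult)
    then show ?thesis unfolding M_def power_add by simp
  qed
  finally show ?thesis .
qed

section \<open>Running through all colours\<close>

context ordered_pattern
begin

text \<open>Each round uses up sparsity, so the exponent of the density decreases with s. The start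
  is free, because for s = 0 every density bound is available.\<close>

lemma has_families_cost:
  assumes "\<And>i f. i < s \<Longrightarrow> \<not> monochromatic_copy i f" and "s \<le> Suc Q"
  shows "has_families s (cost d p L Q s) (n ^ 6 / n ^ dexp p (Suc Q - s))"
  using assms
proof (induction s)
  case 0
  have "has_families 0 1 (n ^ 6 / n ^ dexp p (Suc Q))" by (rule has_families_0) simp
  then show ?case by simp
next
  case (Suc s)
  have Q: "Suc Q - s = Suc (Q - s)" using Suc.prems(2) by simp
  have "has_families s (cost d p L Q s) (n ^ 6 / n ^ dexp p (Suc (Q - s)))"
    using Suc unfolding Q[symmetric] by simp
  moreover have "6 * n ^ 3 * (n ^ 6 / real n ^ dexp p (Suc (Q - s))) \<le>
      1 / real n ^ dexp p (Q - s) * (1 / real n ^ dexp p (Q - s) / n) ^ (p - 1)"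
    by (rule dexp_step[OF n p])
  ultimately have "has_families (Suc s) (L * (cost d p L Q s + d * (dexp p (Q - s) + 2)) + 1)
      (n ^ 6 / n ^ dexp p (Q - s))"
    using Suc.prems(1) by (intro has_families_Suc) auto
  then show ?case by simp
qed

lemma monochromatic_copy_exists:
  assumes S: "finite S" "n ^ cost d p L Q (Suc Q) \<le> card S"
    and c: "\<And>x y. x \<in> S \<Longrightarrow> y \<in> S \<Longrightarrow> x < y \<Longrightarrow> c {x, y} \<le> Suc Q"
  shows "\<exists>i\<le>Suc Q. \<exists>f. monochromatic_copy i f"
proof (cases "\<exists>i<Suc Q. \<exists>f. monochromatic_copy i f")
  case True
  then show ?thesis using less_imp_le by blast
next
  case False
  then have "has_families (Suc Q) (cost d p L Q (Suc Q)) (n ^ 6 / n ^ dexp p (Suc Q - Suc Q))"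
    by (intro has_families_cost) auto
  \<comment> \<open>The initial value 9 of \<open>dexp\<close> is chosen for this: 9 - 6 = 3 is the
    exponent required for the last colour.\<close>
  moreover have "real (n ^ 6) / real (n ^ dexp p (Suc Q - Suc Q)) = 1 / real n ^ 3"
    using n by (simp add: field_simps flip: power_add)
  ultimately have "has_families (Suc Q) (cost d p L Q (Suc Q)) (1 / real n ^ 3)"
    by (simp only:)
  from monochromatic_copy_of_last_colour[OF this S c] show ?thesis by blast
qed

end

section \<open>The interval chromatic number and the theorem\<close>

text \<open>A vertex is numbered by how many cells lie entirely to its left. If u < w are adjacent,
  the cell of u lies entirely left of w, for otherwise it would contain w by convexity; hence the
  number rises strictly.\<close>

lemma interval_colouring_level:
  assumes P: "interval_colouring V E P" and V: "finite V" and E: "\<And>u w. {u, w} \<in> E \<Longrightarrow> u \<in> V \<and> w \<in> V"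
  obtains level :: "'a::linorder \<Rightarrow> nat"
  where "\<And>u w. u \<le> w \<Longrightarrow> level u \<le> level w" "\<And>u w. {u, w} \<in> E \<Longrightarrow> level u \<noteq> level w"
    "\<And>u. u \<in> V \<Longrightarrow> level u < card P"
proof -
  define left where "left u = {I \<in> P. \<forall>x\<in>I. x < u}" for u
  have part: "partition_on V P" using P by (simp add: interval_colouring_def)
  have finP: "finite P" using finite_elements[OF V part] .
  have cell: "\<exists>I\<in>P. u \<in> I" if "u \<in> V" for u
    using part that by (auto simp: partition_on_def)
  have fin: "finite (left u)" for u using finP by (simp add: left_def)
  have mono: "left u \<subseteq> left w" if "u \<le> w" for u w
    using that by (auto simp: left_def)
  have less: "card (left u) < card (left w)" if e: "{u, w} \<in> E" and uw: "u < w" for u w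
  proof (intro psubset_card_mono fin psubsetI mono less_imp_le uw)
    obtain I where I: "I \<in> P" "u \<in> I" using cell[of u] E[OF e] by blast
    have "w \<notin> I" using P I e by (auto simp: interval_colouring_def)
    moreover have "interval_in V I" using P I by (simp add: interval_colouring_def)
    ultimately have "x < w" if "x \<in> I" for x
      using I(2) that E[OF e] uw unfolding interval_in_def by (meson less_imp_le not_less)
    then have "I \<in> left w" using I by (simp add: left_def)
    moreover have "I \<notin> left u" using I by (auto simp: left_def)
    ultimately show "left u \<noteq> left w" by blast
  qed
  have loop: "u \<noteq> w" if e: "{u, w} \<in> E" for u w
  proof
    assume "u = w"
    obtain I where "I \<in> P" "u \<in> I" using cell[of u] E[OF e] by blast
    then have "{u, u} \<notin> E" using P unfolding interval_colouring_def by blast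
    then show False using e \<open>u = w\<close> by simp
  qed
  show thesis
  proof (rule that[of "\<lambda>u. card (left u)"])
    show "card (left u) \<le> card (left w)" if "u \<le> w" for u w
      by (rule card_mono[OF fin mono[OF that]])
    show "card (left u) \<noteq> card (left w)" if e: "{u, w} \<in> E" for u w
      using less[of u w] less[of w u] e loop[OF e] by (cases u w rule: linorder_cases) (auto simp: insert_commute)
    show "card (left u) < card P" if u: "u \<in> V" for u
    proof (intro psubset_card_mono finP psubsetI)
      show "left u \<subseteq> P" by (auto simp: left_def)
      obtain I where "I \<in> P" "u \<in> I" using cell[OF u] by blast
      then show "left u \<noteq> P" by (auto simp: left_def)
    qed
  qed
qed

lemma ceiling_log2_bounds:
  assumes "1 \<le> m"
  shows "m \<le> 2 ^ nat \<lceil>log 2 (real m)\<rceil>" "2 ^ nat \<lceil>log 2 (real m)\<rceil> \<le> 2 * m"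
proof -
  define l where "l = nat \<lceil>log 2 (real m)\<rceil>"
  have "0 \<le> log 2 (real m)" using assms by simp
  then have l: "log 2 (real m) \<le> l" "l < log 2 (real m) + 1" unfolding l_def by linarith+
  have "real m = 2 powr log 2 (real m)" using assms by simp
  also have "\<dots> \<le> 2 powr l" using l(1) by simp
  also have "\<dots> = 2 ^ l" by (simp add: powr_realpow)
  finally show "m \<le> 2 ^ l" by (metis numeral_power_eq_of_nat_cancel_iff of_nat_le_iff of_nat_numeral of_nat_power)
  have "2 ^ l = 2 powr l" by (simp add: powr_realpow)
  also have "\<dots> \<le> 2 powr (log 2 (real m) + 1)" using l(2) by simp
  also have "\<dots> = 2 * real m" using assms by (simp add: powr_add)
  finally have "real (2 ^ l) \<le> real (2 * m)" by simp
  then show "2 ^ l \<le> 2 * m" by (simp only: of_nat_le_iff)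
qed

lemma interval_chromatic_number_attained:
  assumes "ordered_graph V E"
  obtains P where "interval_colouring V E P" "card P = interval_chromatic_number V E"
proof -
  have "\<exists>k P. interval_colouring V E P \<and> card P = k"
    using interval_colouring_exists[OF assms] by blast
  from LeastI_ex[OF this] show thesis
    unfolding interval_chromatic_number_def[symmetric] using that by blast
qed

lemma interval_chromatic_number_le_card:
  assumes "ordered_graph V E"
  shows "interval_chromatic_number V E \<le> card V"
proof -
  have "{u} \<notin> E" for u
    using assms by (auto simp: ordered_graph_def nsets_def)
  then have "interval_colouring V E ((\<lambda>u. {u}) ` V)"
    by (auto simp: interval_colouring_def interval_in_def partition_on_def disjoint_def)
  then have "interval_chromatic_number V E \<le> card ((\<lambda>u. {u}) ` V)"
    unfolding interval_chromatic_number_def by (intro Least_le) blast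
  also have "\<dots> \<le> card V"
    using assms by (intro card_image_le) (simp add: ordered_graph_def)
  finally show ?thesis .
qed

theorem theorem3:
  fixes V :: "'a::linorder set" and E :: "'a set set" and v :: "nat \<Rightarrow> 'a"
    and d q n p \<chi> :: nat
  assumes "d \<ge> 2" and "q \<ge> 2"
    and "ordered_graph V E"
    and "degenerate d V E"
    and "card V = n" and "n \<ge> 3"
    and "E \<noteq> {}"
    and "interval_chromatic_number V E = \<chi>"
    and "degeneracy_ordering d V E v"
    and "p \<ge> 2"
    and "\<And>i j. 1 \<le> i \<Longrightarrow> i < j \<Longrightarrow> j \<le> n \<Longrightarrow> {v i, v j} \<in> E \<Longrightarrow>
           card (nbrs E (v i) \<inter> nbrs E (v j) \<inter> v ` {1..<i}) \<le> p - 1"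
  shows "ordered_ramsey_number V E q
           \<le> n ^ (60 * d * p ^ (q - 2) * nat \<lceil>log 2 (real \<chi>)\<rceil> ^ (q - 1))"
proof -
  have graph: "ordered_graph V E" by fact
  have V: "finite V" "card V = n" and bij: "bij_betw v {1..n} V"
    using assms by (auto simp: ordered_graph_def degeneracy_ordering_def)
  have E: "u \<in> V \<and> w \<in> V \<and> u \<noteq> w" if "{u, w} \<in> E" for u w
    using graph that by (auto simp: ordered_graph_def nsets_2_eq doubleton_eq_iff)
  have inj: "inj_on v {1..n}" using bij by (simp add: bij_betw_def)
  obtain P where P: "interval_colouring V E P" and cP: "card P = \<chi>"
    using interval_chromatic_number_attained[OF graph] assms(8) by metis
  obtain level :: "'a \<Rightarrow> nat" where level: "\<And>u w. u \<le> w \<Longrightarrow> level u \<le> level w"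
    "\<And>u w. {u, w} \<in> E \<Longrightarrow> level u \<noteq> level w" "\<And>u. u \<in> V \<Longrightarrow> level u < \<chi>"
    using interval_colouring_level[OF P V(1)] E unfolding cP by blast
  obtain e where "e \<in> E" using \<open>E \<noteq> {}\<close> by blast
  then have "e \<in> [V]\<^bsup>2\<^esup>" using graph by (auto simp: ordered_graph_def)
  then obtain a b where "e = {a, b}" by (auto simp: nsets_2_eq)
  then have "{a, b} \<in> E" using \<open>e \<in> E\<close> by simp
  \<comment> \<open>The two ends of an edge have different levels. Hence L \<ge> 1 below, as
    \<open>cost_le\<close> requires.\<close>
  then have \<chi>2: "2 \<le> \<chi>"
    using level(2)[of a b] level(3)[of a] level(3)[of b] E[of a b] by linarith
  define L where "L = nat \<lceil>log 2 (real \<chi>)\<rceil>"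
  have L: "\<chi> \<le> 2 ^ L" "2 ^ L \<le> 2 * n"
    using ceiling_log2_bounds[of \<chi>] \<chi>2 interval_chromatic_number_le_card[OF graph] assms(8) V(2)
    unfolding L_def by linarith+
  have L1: "1 \<le> L"
    using L(1) \<chi>2 by (cases L) auto
  \<comment> \<open>The colours are 0 to \<open>Suc Q\<close>; all but the last one,
    \<open>Suc Q\<close> in number, are made sparse.\<close>
  define Q where "Q = q - 2"
  have q: "q = Suc (Suc Q)" using \<open>2 \<le> q\<close> by (simp add: Q_def)
  define N where "N = n ^ (60 * d * p ^ (q - 2) * L ^ (q - 1))"
  have "cost d p L Q (Suc Q) \<le> 42 * d * p ^ Q * L ^ Suc Q"
    using cost_le[OF \<open>2 \<le> d\<close> \<open>2 \<le> p\<close> L1 order_refl, of Q] by linarith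
  also have "\<dots> \<le> 60 * d * p ^ (q - 2) * L ^ (q - 1)"
    unfolding q by simp
  finally have N: "n ^ cost d p L Q (Suc Q) \<le> card {..<N}"
    unfolding N_def card_lessThan using \<open>3 \<le> n\<close> by (intro power_increasing) auto
  have "ordered_arrows N V E q"
    unfolding ordered_arrows_def
  proof
    fix c assume c: "c \<in> [{..<N}]\<^bsup>2\<^esup> \<rightarrow> {..<q}"
    interpret ordered_pattern V E v n d p L level c "{..<N}"
    proof (unfold_locales, goal_cases)
      case (7 u w)
      then show ?case by (rule E)
    next
      case (8 j)
      have image: "v ` {i \<in> {1..<j}. {v i, v j} \<in> E} = nbrs E (v j) \<inter> v ` {1..<j}"
        by (auto simp: nbrs_def)
      have "inj_on v {i \<in> {1..<j}. {v i, v j} \<in> E}"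
        using 8 by (intro inj_on_subset[OF inj]) auto
      from card_image[OF this] have "card {i \<in> {1..<j}. {v i, v j} \<in> E} = card (nbrs E (v j) \<inter> v ` {1..<j})"
        unfolding image by (rule sym)
      then show ?case using 8 assms(9) V(2) by (simp add: degeneracy_ordering_def)
    next
      case (9 i j)
      have image: "v ` {k \<in> {1..<i}. {v k, v i} \<in> E \<and> {v k, v j} \<in> E}
          = nbrs E (v i) \<inter> nbrs E (v j) \<inter> v ` {1..<i}"
        by (auto simp: nbrs_def)
      have "inj_on v {k \<in> {1..<i}. {v k, v i} \<in> E \<and> {v k, v j} \<in> E}"
        using 9 by (intro inj_on_subset[OF inj]) auto
      from card_image[OF this] have "card {k \<in> {1..<i}. {v k, v i} \<in> E \<and> {v k, v j} \<in> E}
          = card (nbrs E (v i) \<inter> nbrs E (v j) \<inter> v ` {1..<i})"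
        unfolding image by (rule sym)
      then show ?case using assms(11)[OF 9] by simp
    next
      case (12 u)
      then show ?case using level(3)[of u] L(1) by linarith
    next
      case (11 u w)
      then show ?case by (rule level(2))
    next
      case 10
      then show ?case by (intro level(1))
    qed (use \<open>3 \<le> n\<close> \<open>2 \<le> d\<close> \<open>2 \<le> p\<close> V bij L(2) in simp_all)
    have "c {x, y} \<le> Suc Q" if "x \<in> {..<N}" "y \<in> {..<N}" "x < y" for x y
    proof -
      have "{x, y} \<in> [{..<N}]\<^bsup>2\<^esup>" using that by (auto simp: nsets_2_eq)
      then have "c {x, y} < q" using c by blast
      then show ?thesis using q by simp
    qed
    from monochromatic_copy_exists[OF _ N this] obtain i f
      where i: "i \<le> Suc Q" and f: "monochromatic_copy i f" by auto
    have mono: "strict_mono_on V f" and sub: "f ` V \<subseteq> {..<N}"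
      and col: "\<And>u w. {u, w} \<in> E \<Longrightarrow> c {f u, f w} = i"
      using f unfolding monochromatic_copy_def by blast+
    have "{f u, f w} \<in> {e \<in> [{..<N}]\<^bsup>2\<^esup>. c e = i}" if uw: "{u, w} \<in> E" for u w
    proof -
      have "f u \<noteq> f w"
        using strict_mono_on_imp_inj_on[OF mono] E[OF uw] by (auto dest: inj_onD)
      then have "{f u, f w} \<in> [{..<N}]\<^bsup>2\<^esup>"
        using sub E[OF uw] by (auto simp: nsets_2_eq)
      then show ?thesis using col[OF uw] by simp
    qed
    then have "ordered_copy V E {..<N} {e \<in> [{..<N}]\<^bsup>2\<^esup>. c e = i}"
      unfolding ordered_copy_def using mono sub by blast
    then show "\<exists>i<q. ordered_copy V E {..<N} {e \<in> [{..<N}]\<^bsup>2\<^esup>. c e = i}"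
      using i unfolding q less_Suc_eq_le by blast
  qed
  then have "ordered_ramsey_number V E q \<le> N"
    unfolding ordered_ramsey_number_def by (rule Least_le)
  then show ?thesis unfolding N_def L_def .
qed

end
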